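(* Let $p$ be an odd prime and $G$ an extraspecial $p$-group of exponent $p^2$, with $V,B,T$ and a special symplectic basis $\{v_1,w_1,\dots,v_n,w_n\}$ as in the context. (i) Let $g,h\in G$ with $gZ(G),hZ(G)\notin\mathrm{span}(w_1)\setminus\{0\}$. Then $g$ and $h$ are automorphic if and only if they have the same order and ($g\in Z(G)\iff h\in Z(G)$). (ii) The number of orbits of the natural action of $\mathrm{Aut}(G)$ on $G$ is $p+2$ if $|G|=p^3$, and $p+3$ if $|G|>p^3$.
   Context: A special $p$-group is a finite $p$-group whose center, derived subgroup and Frattini subgroup coincide and are elementary abelian; it is extraspecial if $|Z(G)|=p$. $V=G/Z(G)$ as a $GF(p)$-vector space, $Z(G)$ identified with $GF(p)$, $B(gZ(G),hZ(G))=[g,h]=ghg^{-1}h^{-1}$, $T(gZ(G))=g^p$. A special symplectic basis is a basis $\{v_1,w_1,\dots,v_n,w_n\}$ of $V$ with $B(v_i,w_i)=1$, $B(v_i,w_j)=B(v_i,v_j)=B(w_i,w_j)=0$ for $i\ne j$, $T(v_1)=1$ and $T(u)=0$ for all other basis vectors $u$; such a basis exists. Elements $g,h$ are automorphic if $\varphi(g)=h$ for some $\varphi\in\mathrm{Aut}(G)$. *)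

theory Defs
  imports "HOL-Algebra.Algebra"
begin

definition center :: "('a, 'b) monoid_scheme \<Rightarrow> 'a set" where
  "center G = {z \<in> carrier G. \<forall>g \<in> carrier G. z \<otimes>\<^bsub>G\<^esub> g = g \<otimes>\<^bsub>G\<^esub> z}"

definition maximal_subgroup :: "'a set \<Rightarrow> ('a, 'b) monoid_scheme \<Rightarrow> bool" where
  "maximal_subgroup H G \<longleftrightarrow> subgroup H G \<and> H \<noteq> carrier G \<and>
     (\<forall>K. subgroup K G \<and> H \<subseteq> K \<longrightarrow> K = H \<or> K = carrier G)"

text \<open>Frattini subgroup: intersection of all maximal subgroups (the whole group if there are none).\<close>
definition frattini :: "('a, 'b) monoid_scheme \<Rightarrow> 'a set" where
  "frattini G = carrier G \<inter> \<Inter> {H. maximal_subgroup H G}"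

definition p_group :: "nat \<Rightarrow> ('a, 'b) monoid_scheme \<Rightarrow> bool" where
  "p_group p G \<longleftrightarrow> group G \<and> finite (carrier G) \<and> (\<exists>k::nat. card (carrier G) = p ^ k)"

definition elementary_abelian :: "nat \<Rightarrow> 'a set \<Rightarrow> ('a, 'b) monoid_scheme \<Rightarrow> bool" where
  "elementary_abelian p H G \<longleftrightarrow>
     (\<forall>x \<in> H. \<forall>y \<in> H. x \<otimes>\<^bsub>G\<^esub> y = y \<otimes>\<^bsub>G\<^esub> x) \<and> (\<forall>x \<in> H. x [^]\<^bsub>G\<^esub> p = \<one>\<^bsub>G\<^esub>)"

definition special_p_group :: "nat \<Rightarrow> ('a, 'b) monoid_scheme \<Rightarrow> bool" where
  "special_p_group p G \<longleftrightarrow> p_group p G \<and>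
     center G = derived G (carrier G) \<and> derived G (carrier G) = frattini G \<and>
     elementary_abelian p (center G) G"

definition extraspecial_p_group :: "nat \<Rightarrow> ('a, 'b) monoid_scheme \<Rightarrow> bool" where
  "extraspecial_p_group p G \<longleftrightarrow> special_p_group p G \<and> card (center G) = p"

definition group_exponent :: "('a, 'b) monoid_scheme \<Rightarrow> nat" where
  "group_exponent G = (LEAST n. 0 < n \<and> (\<forall>x \<in> carrier G. x [^]\<^bsub>G\<^esub> n = \<one>\<^bsub>G\<^esub>))"

definition comm :: "('a, 'b) monoid_scheme \<Rightarrow> 'a \<Rightarrow> 'a \<Rightarrow> 'a" where
  "comm G g h = g \<otimes>\<^bsub>G\<^esub> h \<otimes>\<^bsub>G\<^esub> inv\<^bsub>G\<^esub> g \<otimes>\<^bsub>G\<^esub> inv\<^bsub>G\<^esub> h"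

text \<open>V = G/Z(G), written additively as the abelian group G Mod Z(G); its elements are
  the cosets Z #> g.  Z(G) is identified with GF(p) via the generator z (z^k corresponds to k mod p).
  v, w :: nat => 'a are representatives of the basis vectors v_i Z(G), w_i Z(G), i = 1..n.
  The basis condition: every vector of V is uniquely a linear combination
  sum_i (e_i v_i + f_i w_i) with coefficients in {0..p-1}.\<close>
definition V_comb :: "('a, 'b) monoid_scheme \<Rightarrow> nat \<Rightarrow> (nat \<Rightarrow> 'a) \<Rightarrow> (nat \<Rightarrow> 'a)
    \<Rightarrow> (nat \<Rightarrow> nat) \<Rightarrow> (nat \<Rightarrow> nat) \<Rightarrow> 'a set" where
  "V_comb G n v w e f = finprod (G Mod center G)
     (\<lambda>i. ((center G #>\<^bsub>G\<^esub> v i) [^]\<^bsub>G Mod center G\<^esub> e i) \<otimes>\<^bsub>G Mod center G\<^esub>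
          ((center G #>\<^bsub>G\<^esub> w i) [^]\<^bsub>G Mod center G\<^esub> f i)) {1..n}"

definition is_V_basis :: "nat \<Rightarrow> ('a, 'b) monoid_scheme \<Rightarrow> nat \<Rightarrow> (nat \<Rightarrow> 'a) \<Rightarrow> (nat \<Rightarrow> 'a) \<Rightarrow> bool" where
  "is_V_basis p G n v w \<longleftrightarrow>
     (\<forall>i \<in> {1..n}. v i \<in> carrier G \<and> w i \<in> carrier G) \<and>
     (\<forall>c \<in> carrier (G Mod center G). \<exists>!ef.
        (\<forall>i. (i \<in> {1..n} \<longrightarrow> fst ef i < p \<and> snd ef i < p) \<and>
              (i \<notin> {1..n} \<longrightarrow> fst ef i = 0 \<and> snd ef i = 0)) \<and>
        c = V_comb G n v w (fst ef) (snd ef))"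

definition special_symplectic_basis ::
    "nat \<Rightarrow> ('a, 'b) monoid_scheme \<Rightarrow> 'a \<Rightarrow> nat \<Rightarrow> (nat \<Rightarrow> 'a) \<Rightarrow> (nat \<Rightarrow> 'a) \<Rightarrow> bool" where
  "special_symplectic_basis p G z n v w \<longleftrightarrow>
     z \<in> center G \<and> z \<noteq> \<one>\<^bsub>G\<^esub> \<and>
     is_V_basis p G n v w \<and>
     (\<forall>i \<in> {1..n}. \<forall>j \<in> {1..n}.
        comm G (v i) (w j) = (if i = j then z else \<one>\<^bsub>G\<^esub>) \<and>
        (i \<noteq> j \<longrightarrow> comm G (v i) (v j) = \<one>\<^bsub>G\<^esub> \<and> comm G (w i) (w j) = \<one>\<^bsub>G\<^esub>)) \<and>
     1 \<le> n \<and>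
     v 1 [^]\<^bsub>G\<^esub> p = z \<and>
     (\<forall>i \<in> {2..n}. v i [^]\<^bsub>G\<^esub> p = \<one>\<^bsub>G\<^esub>) \<and>
     (\<forall>i \<in> {1..n}. w i [^]\<^bsub>G\<^esub> p = \<one>\<^bsub>G\<^esub>)"

definition automorphic :: "('a, 'b) monoid_scheme \<Rightarrow> 'a \<Rightarrow> 'a \<Rightarrow> bool" where
  "automorphic G g h \<longleftrightarrow> (\<exists>\<phi> \<in> iso G G. \<phi> g = h)"

definition aut_orbits :: "('a, 'b) monoid_scheme \<Rightarrow> 'a set set" where
  "aut_orbits G = (\<lambda>g. {\<phi> g | \<phi>. \<phi> \<in> iso G G}) ` carrier G"

end

theory Submission
  imports Defs "HOL-Number_Theory.Cong"
begin

text \<open>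
  Since \<open>p\<close> is odd, \<open>x \<mapsto> x\<^sup>p\<close> is a homomorphism into the center, and nondegeneracy of the
  commutator form represents it as \<open>x\<^sup>p = [x, w]\<close>.  Every automorphism fixes the coset \<open>w Z(G)\<close>,
  because this equation determines it.  This accounts for the \<open>p - 1\<close> exceptional orbits
  \<open>w\<^sup>k Z(G)\<close>.  All other fusion comes from three kinds of automorphisms: inner ones move an
  element within its coset, transvections along an element of order dividing \<open>p\<close> move \<open>g Z(G)\<close>
  to \<open>h Z(G)\<close> when \<open>g\<^sup>p = h\<^sup>p\<close>, and similitudes, obtained by splitting off hyperbolic planes,
  act on the center by an arbitrary power.  For the middle kind, two elements outside the double
  centralizer of \<open>w\<close> that commute are joined through a third that commutes with neither.
\<close>

subsection \<open>Commutators in class two\<close>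

text \<open>The orbits are \<open>{1}\<close>, \<open>Z - {1}\<close>, the elements of order
  \<open>p^2\<close>, the \<open>p - 1\<close> exceptional cosets, and the elements of order
  \<open>p\<close> outside the preimage \<open>W\<close> of the line through \<open>w\<close>. This
  makes \<open>p + 2\<close> orbits, plus one if the last class is nonempty. The kernel
  \<open>K\<close> of the \<open>p\<close>-th power map has index \<open>p\<close> and
  \<open>W\<close> has \<open>p^2\<close> elements, so \<open>K = W\<close> exactly when
  \<open>|G| = p^3\<close>. The obstacle is that automorphisms are needed on \<open>G\<close>, not
  merely on \<open>G/Z\<close>: a similitude of the commutator form lifts only if it also respects
  \<open>p\<close>-th powers. Within a hyperbolic plane the multiplier \<open>k\<close> is therefore
  put wholly on \<open>v\<close>, as \<open>v -> v^k\<close> and \<open>w -> w\<close>, with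
  \<open>w\<close> chosen so that \<open>w^p = 1\<close>. The central element \<open>v^p\<close>
  then goes to its \<open>k\<close>-th power, as every central element must. Bijectivity comes
  cheaply: an endomorphism that does not kill \<open>z\<close> is an automorphism.\<close>

lemma (in group) commI:
  assumes "x \<in> carrier G" "y \<in> carrier G" "c \<in> carrier G" "x \<otimes> y = c \<otimes> (y \<otimes> x)"
  shows "comm G x y = c"
proof -
  have "comm G x y = c \<otimes> (y \<otimes> x) \<otimes> inv x \<otimes> inv y"
    using assms by (simp add: comm_def)
  also have "\<dots> = c"
    using assms(1-3) by (simp add: m_assoc)
  finally show ?thesis .
qed

lemma (in group) mult_comm_swap:
  assumes "x \<in> carrier G" "y \<in> carrier G"
  shows "x \<otimes> y = comm G x y \<otimes> (y \<otimes> x)"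
  using assms by (simp add: comm_def m_assoc) (simp flip: m_assoc)

lemma (in group) comm_closed [simp, intro]:
  "x \<in> carrier G \<Longrightarrow> y \<in> carrier G \<Longrightarrow> comm G x y \<in> carrier G"
  by (simp add: comm_def)

lemma (in group) comm_eq_one_iff:
  assumes "x \<in> carrier G" "y \<in> carrier G"
  shows "comm G x y = \<one> \<longleftrightarrow> x \<otimes> y = y \<otimes> x"
  using assms commI[of x y \<one>] mult_comm_swap[of x y] by auto

lemma (in group) center_closed: "c \<in> center G \<Longrightarrow> c \<in> carrier G"
  by (simp add: center_def)

lemma (in group) center_commute:
  "c \<in> center G \<Longrightarrow> x \<in> carrier G \<Longrightarrow> c \<otimes> x = x \<otimes> c"
  by (simp add: center_def)

lemma (in group) center_left_commute:
  assumes "c \<in> center G" "x \<in> carrier G" "y \<in> carrier G"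
  shows "x \<otimes> (c \<otimes> y) = c \<otimes> (x \<otimes> y)"
  using assms by (metis center_closed center_commute m_assoc)

text \<open>The rule is permutative, so the simplifier uses it only in the direction that lowers the
  term order. With both orientations a central factor can move either way.\<close>

lemmas (in group) center_ac = center_left_commute center_left_commute[symmetric]

lemma (in group) center_subgroup: "subgroup (center G) G"
proof (rule subgroupI)
  fix a assume a: "a \<in> center G"
  have "inv a \<otimes> x = x \<otimes> inv a" if x: "x \<in> carrier G" for x
  proof -
    have "inv a \<otimes> x = inv a \<otimes> (x \<otimes> a) \<otimes> inv a"
      using a x center_closed by (simp add: m_assoc)
    also have "x \<otimes> a = a \<otimes> x"
      by (rule center_commute[OF a x, symmetric])
    also have "inv a \<otimes> (a \<otimes> x) \<otimes> inv a = x \<otimes> inv a"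
      using a x center_closed by (simp flip: m_assoc)
    finally show ?thesis .
  qed
  moreover have "inv a \<in> carrier G"
    using a center_closed by simp
  ultimately show "inv a \<in> center G"
    unfolding center_def by blast
next
  fix a b assume a: "a \<in> center G" and b: "b \<in> center G"
  have "a \<otimes> b \<otimes> x = x \<otimes> (a \<otimes> b)" if x: "x \<in> carrier G" for x
    using center_left_commute[OF a x center_closed[OF b]] center_commute[OF b x]
    by (simp add: m_assoc a b x center_closed)
  moreover have "a \<otimes> b \<in> carrier G"
    using a b center_closed by simp
  ultimately show "a \<otimes> b \<in> center G"
    unfolding center_def by blast
qed (auto simp: center_def)

lemma (in group) hom_comm:
  assumes "f \<in> hom G G" "x \<in> carrier G" "y \<in> carrier G"
  shows "f (comm G x y) = comm G (f x) (f y)"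
proof -
  interpret f: group_hom G G f by unfold_locales (rule assms(1))
  show ?thesis using assms(2,3) by (simp add: comm_def)
qed

lemma (in group) hom_pow:
  assumes "f \<in> hom G G" "x \<in> carrier G"
  shows "f (x [^] (n::nat)) = f x [^] n" "f (x [^] (i::int)) = f x [^] i"
proof -
  interpret f: group_hom G G f by unfold_locales (rule assms(1))
  show "f (x [^] (n::nat)) = f x [^] n" "f (x [^] (i::int)) = f x [^] i"
    using assms(2) by (simp_all add: f.hom_nat_pow f.hom_int_pow)
qed

text \<open>The generator \<open>z\<close> is a parameter, so that it can be the \<open>z\<close> of
  a given basis, or be exchanged for another nontrivial central element as in
  \<open>center_generator\<close>.\<close>

locale cyclic_center_class2 = group G for G (structure) +
  fixes p :: nat and z
  assumes p_prime: "Factorial_Ring.prime p"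
    and p_odd: "odd p"
    and finite_carrier: "finite (carrier G)"
    and z_center: "z \<in> center G"
    and z_nontrivial: "z \<noteq> \<one>"
    and card_center: "card (center G) = p"
    and comm_center: "x \<in> carrier G \<Longrightarrow> y \<in> carrier G \<Longrightarrow> comm G x y \<in> center G"
begin

lemma z_closed [simp, intro]: "z \<in> carrier G"
  using z_center center_closed by blast

lemma finite_center: "finite (center G)"
  using finite_carrier center_closed by (meson finite_subset subsetI)

lemma z_pow_center [simp, intro]: "z [^] (i::int) \<in> center G"
  using center_subgroup z_center by (rule subgroup_int_pow_closed)

lemma center_pow_p:
  assumes "c \<in> center G" shows "c [^] p = \<one>"
proof -
  interpret Z: group "G\<lparr>carrier := center G\<rparr>"
    by (rule subgroup.subgroup_is_group[OF center_subgroup]) (rule is_group)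
  have "c [^]\<^bsub>G\<lparr>carrier := center G\<rparr>\<^esub> order (G\<lparr>carrier := center G\<rparr>) = \<one>"
    using Z.pow_order_eq_1[of c] assms by simp
  then show ?thesis
    using card_center by (simp add: order_def nat_pow_consistent[symmetric])
qed

lemma ord_z: "ord z = p"
proof -
  have "ord z dvd p" using center_pow_p[OF z_center] pow_eq_id by simp
  moreover have "ord z \<noteq> 1" using z_nontrivial ord_eq_1 by simp
  ultimately show ?thesis using p_prime by (auto simp: prime_nat_iff)
qed

lemma z_pow_eq_iff: "z [^] (i::int) = z [^] (j::int) \<longleftrightarrow> [i = j] (mod int p)"
  by (metis int_pow_eq ord_z cong_iff_dvd_diff dvd_diff_commute z_closed)

lemma z_pow_eq_one_iff: "z [^] (i::int) = \<one> \<longleftrightarrow> int p dvd i"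
  by (simp add: int_pow_eq_id ord_z)

lemma pow_cong:
  assumes "a \<in> carrier G" "a [^] p = \<one>" "[i = j] (mod int p)"
  shows "a [^] (i::int) = a [^] j"
proof -
  have "int (ord a) dvd int p" using assms by (simp add: pow_eq_id)
  moreover have "int p dvd j - i" using assms(3) by (metis cong_iff_dvd_diff dvd_diff_commute)
  ultimately show ?thesis
    using assms(1) by (metis int_pow_eq dvd_trans)
qed

lemma center_eq: "center G = range (\<lambda>i::int. z [^] i)"
proof -
  have "inj_on (\<lambda>k. z [^] int k) {..<p}"
    by (intro inj_onI) (simp add: z_pow_eq_iff cong_int_iff cong_less_modulus_unique_nat)
  then have "card ((\<lambda>k. z [^] int k) ` {..<p}) = card (center G)"
    by (simp add: card_image card_center)
  then have "(\<lambda>k. z [^] int k) ` {..<p} = center G"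
    by (intro card_subset_eq) (auto simp: finite_center)
  then show ?thesis by auto
qed

lemma centerE:
  assumes "c \<in> center G" obtains i :: int where "c = z [^] i"
  using assms center_eq by auto

text \<open>The symplectic form on \<open>G/Z\<close>, lifted to the integers to serve as an
  exponent. The representative is arbitrary, so its laws hold only modulo \<open>p\<close>.\<close>

definition B :: "'a \<Rightarrow> 'a \<Rightarrow> int" where
  "B x y = (SOME i. comm G x y = z [^] i)"

lemma comm_eq_B:
  assumes "x \<in> carrier G" "y \<in> carrier G"
  shows "comm G x y = z [^] B x y"
  unfolding B_def by (rule someI_ex) (use comm_center[OF assms] centerE in metis)

lemma B_cong_iff:
  assumes "x \<in> carrier G" "y \<in> carrier G"
  shows "comm G x y = z [^] i \<longleftrightarrow> [B x y = i] (mod int p)"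
  using assms by (simp add: comm_eq_B z_pow_eq_iff)

lemma comm_mult_left:
  assumes "x \<in> carrier G" "y \<in> carrier G" "u \<in> carrier G"
  shows "comm G (x \<otimes> y) u = comm G x u \<otimes> comm G y u"
proof (rule commI)
  have "x \<otimes> y \<otimes> u = x \<otimes> (comm G y u \<otimes> (u \<otimes> y))"
    using assms mult_comm_swap[of y u] by (simp add: m_assoc)
  also have "\<dots> = comm G y u \<otimes> (x \<otimes> u \<otimes> y)"
    using assms by (simp add: center_ac comm_center m_assoc)
  also have "x \<otimes> u = comm G x u \<otimes> (u \<otimes> x)"
    using assms by (intro mult_comm_swap)
  also have "comm G y u \<otimes> (comm G x u \<otimes> (u \<otimes> x) \<otimes> y) = comm G x u \<otimes> comm G y u \<otimes> (u \<otimes> (x \<otimes> y))"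
    using assms by (simp add: m_assoc center_ac comm_center)
  finally show "x \<otimes> y \<otimes> u = comm G x u \<otimes> comm G y u \<otimes> (u \<otimes> (x \<otimes> y))" .
qed (use assms in auto)

lemma comm_inverse:
  assumes "x \<in> carrier G" "y \<in> carrier G"
  shows "comm G y x = inv (comm G x y)"
  using assms by (simp add: comm_def inv_mult_group m_assoc)

lemma comm_mult_right:
  assumes "x \<in> carrier G" "y \<in> carrier G" "u \<in> carrier G"
  shows "comm G u (x \<otimes> y) = comm G u x \<otimes> comm G u y"
proof -
  have "comm G u (x \<otimes> y) = inv (comm G x u \<otimes> comm G y u)"
    using assms by (simp add: comm_inverse[of _ u] comm_mult_left comm_inverse[of "x \<otimes> y" u])
  also have "\<dots> = comm G u y \<otimes> comm G u x"
    using assms by (simp add: inv_mult_group comm_inverse[of _ u])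
  also have "\<dots> = comm G u x \<otimes> comm G u y"
    using assms by (simp add: center_commute comm_center)
  finally show ?thesis .
qed

lemma comm_center_left [simp]: "c \<in> center G \<Longrightarrow> x \<in> carrier G \<Longrightarrow> comm G c x = \<one>"
  using comm_eq_one_iff[of c x] center_closed[of c] center_commute[of c x] by blast

lemma comm_center_right [simp]: "c \<in> center G \<Longrightarrow> x \<in> carrier G \<Longrightarrow> comm G x c = \<one>"
  using comm_eq_one_iff[of x c] center_closed[of c] center_commute[of c x] by simp

lemma comm_self [simp]: "x \<in> carrier G \<Longrightarrow> comm G x x = \<one>"
  by (simp add: comm_eq_one_iff)

lemma comm_left_hom: "u \<in> carrier G \<Longrightarrow> (\<lambda>x. comm G x u) \<in> hom G G"
  by (auto simp: hom_def comm_mult_left)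

lemma comm_right_hom: "u \<in> carrier G \<Longrightarrow> comm G u \<in> hom G G"
  by (auto simp: hom_def comm_mult_right)

lemma comm_pow_left:
  "x \<in> carrier G \<Longrightarrow> u \<in> carrier G \<Longrightarrow> comm G (x [^] (n::nat)) u = comm G x u [^] n"
  "x \<in> carrier G \<Longrightarrow> u \<in> carrier G \<Longrightarrow> comm G (x [^] (i::int)) u = comm G x u [^] i"
  using hom_pow[OF comm_left_hom] by auto

lemma comm_pow_right:
  "x \<in> carrier G \<Longrightarrow> u \<in> carrier G \<Longrightarrow> comm G u (x [^] (n::nat)) = comm G u x [^] n"
  "x \<in> carrier G \<Longrightarrow> u \<in> carrier G \<Longrightarrow> comm G u (x [^] (i::int)) = comm G u x [^] i"
  using hom_pow[OF comm_right_hom] by auto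

lemma centerI:
  assumes "x \<in> carrier G" "\<And>y. y \<in> carrier G \<Longrightarrow> comm G x y = \<one>"
  shows "x \<in> center G"
  using assms by (auto simp: center_def comm_eq_one_iff)

text \<open>\<open>[x^p, y] = [x, y]^p = 1\<close>, as \<open>[x, y]\<close> lies in a center of
  order \<open>p\<close>.\<close>

lemma pow_p_center:
  assumes "x \<in> carrier G" shows "x [^] p \<in> center G"
  using assms by (intro centerI) (auto simp: comm_pow_left center_pow_p comm_center)

text \<open>Collecting the factors \<open>x\<close> of \<open>(x y)^n\<close> on the left moves each
  past the earlier factors \<open>y\<close>. There are \<open>n (n - 1) / 2\<close> such pairs, and
  each leaves one central \<open>[y, x]\<close>.\<close>

lemma pow_mult_class2:
  assumes x: "x \<in> carrier G" and y: "y \<in> carrier G"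
  shows "(x \<otimes> y) [^] (n::nat) = comm G y x [^] (n * (n - 1) div 2) \<otimes> (x [^] n \<otimes> y [^] n)"
proof (induction n)
  case (Suc n)
  let ?c = "comm G y x" and ?e = "n * (n - 1) div 2"
  have c: "?c \<in> center G" "?c \<in> carrier G" using x y comm_center by auto
  have ck: "?c [^] k \<in> center G" for k :: nat
    using subgroup.m_closed[OF center_subgroup] c subgroup.one_closed[OF center_subgroup]
    by (induction k) auto
  have "(x \<otimes> y) [^] Suc n = ?c [^] ?e \<otimes> (x [^] n \<otimes> (y [^] n \<otimes> x) \<otimes> y)"
    using Suc x y by (simp add: m_assoc)
  also have "y [^] n \<otimes> x = ?c [^] n \<otimes> (x \<otimes> y [^] n)"
    using x y mult_comm_swap[of "y [^] n" x] by (simp add: comm_pow_left)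
  also have "?c [^] ?e \<otimes> (x [^] n \<otimes> (?c [^] n \<otimes> (x \<otimes> y [^] n)) \<otimes> y)
      = ?c [^] ?e \<otimes> (?c [^] n \<otimes> (x [^] Suc n \<otimes> y [^] Suc n))"
    using x y c ck[of n] by (simp add: m_assoc center_ac)
  also have "\<dots> = ?c [^] (?e + n) \<otimes> (x [^] Suc n \<otimes> y [^] Suc n)"
    using x y c by (simp add: m_assoc[symmetric] nat_pow_mult del: nat_pow_Suc)
  also have "?e + n = Suc n * (Suc n - 1) div 2"
    by (cases n) (auto simp: algebra_simps)
  finally show ?case .
qed (use x y in auto)

text \<open>For odd \<open>p\<close> the exponent \<open>p (p - 1) / 2\<close> is a multiple of
  \<open>p\<close>, so it kills the commutator factor.\<close>

lemma pow_p_hom: "(\<lambda>x. x [^] p) \<in> hom G G"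
proof -
  have "(x \<otimes> y) [^] p = x [^] p \<otimes> y [^] p" if "x \<in> carrier G" "y \<in> carrier G" for x y
  proof -
    obtain q where q: "p = 2 * q + 1" using p_odd by (rule oddE)
    then have "p * (p - 1) div 2 = p * q" by simp
    then show ?thesis
      using that pow_mult_class2[OF that, of p]
      by (simp add: nat_pow_pow[symmetric] center_pow_p comm_center)
  qed
  then show ?thesis by (auto simp: hom_def)
qed

text \<open>The center has prime order, so \<open>c\<close> can take the place of
  \<open>z\<close>.\<close>

lemma center_generator:
  assumes "c \<in> center G" "c \<noteq> \<one>" "d \<in> center G"
  obtains m :: int where "d = c [^] m"
proof -
  interpret c: cyclic_center_class2 G p c
    using assms(1,2) p_prime p_odd finite_carrier card_center comm_center by unfold_locales
  show thesis using c.centerE[OF assms(3)] that by blast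
qed

text \<open>\<open>u -> [u, x]\<close> is a homomorphism into a group of prime order, so one
  nontrivial value at \<open>y\<close> makes the powers of \<open>y\<close> reach every value.
  Staying inside \<open>H\<close> matters for \<open>hyperbolic_pair\<close>.\<close>

lemma commutator_surj:
  assumes "subgroup H G" "y \<in> H" "x \<in> carrier G" "comm G y x \<noteq> \<one>" "c \<in> center G"
  obtains u where "u \<in> H" "comm G u x = c"
proof -
  have y: "y \<in> carrier G" using assms(1,2) subgroup.mem_carrier by metis
  obtain m :: int where "c = comm G y x [^] m"
    using center_generator[OF comm_center[OF y assms(3)] assms(4,5)] .
  then have "comm G (y [^] m) x = c" using y assms(3) by (simp add: comm_pow_left)
  moreover have "y [^] m \<in> H" using assms(1,2) by (rule subgroup_int_pow_closed)
  ultimately show thesis using that by blast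
qed

lemma not_centerE:
  assumes "x \<in> carrier G" "x \<notin> center G" "c \<in> center G"
  obtains u where "u \<in> carrier G" "comm G u x = c"
proof -
  obtain y where y: "y \<in> carrier G" "comm G x y \<noteq> \<one>" using assms centerI by blast
  then have "comm G y x \<noteq> \<one>" using assms(1) by (simp add: comm_eq_one_iff)
  then show thesis
    using commutator_surj[OF subgroup_self y(1) assms(1) _ assms(3)] that by blast
qed

text \<open>Every nontrivial normal subgroup contains \<open>z\<close>.\<close>
lemma hom_iso:
  assumes f: "f \<in> hom G G" and fz: "f z \<noteq> \<one>"
  shows "f \<in> iso G G"
proof -
  interpret f: group_hom G G f by unfold_locales (rule f)
  have ker: "x = \<one>" if x: "x \<in> carrier G" and fx: "f x = \<one>" for x
  proof (rule ccontr)
    assume x1: "x \<noteq> \<one>"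
    show False
    proof (cases "x \<in> center G")
      case True
      obtain m :: int where "z = x [^] m" using center_generator[OF True x1 z_center] .
      then show False using fz fx x f by (simp add: hom_pow)
    next
      case False
      obtain u where "u \<in> carrier G" "comm G u x = z"
        using not_centerE[OF x False z_center] .
      then show False using fz fx x hom_comm[OF f, of u x] by (simp add: comm_eq_one_iff)
    qed
  qed
  have inj: "inj_on f (carrier G)"
    using ker by (auto simp: f.inj_iff_trivial_ker kernel_def)
  moreover have "f ` carrier G = carrier G"
    using inj f by (intro card_subset_eq[OF finite_carrier]) (auto simp: hom_def card_image)
  ultimately show ?thesis using f by (simp add: iso_def bij_betw_def)
qed

lemma automorphicI: "f \<in> hom G G \<Longrightarrow> f z \<noteq> \<one> \<Longrightarrow> f x = y \<Longrightarrow> automorphic G x y"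
  unfolding automorphic_def using hom_iso by blast

lemma automorphic_refl: "automorphic G x x"
  by (rule automorphicI[of "\<lambda>x. x"]) (auto simp: hom_def z_nontrivial)

lemma automorphic_trans:
  "automorphic G x y \<Longrightarrow> automorphic G y u \<Longrightarrow> automorphic G x u"
  unfolding automorphic_def using iso_set_trans[of _ G G _ G] by (metis comp_apply)

text \<open>Realised by an inner automorphism.\<close>
lemma automorphic_center_mult:
  assumes x: "x \<in> carrier G" "x \<notin> center G" and c: "c \<in> center G"
  shows "automorphic G x (c \<otimes> x)"
proof -
  obtain u where u: "u \<in> carrier G" "comm G u x = c" using not_centerE[OF x c] .
  \<comment> \<open>Conjugation by \<open>u\<close>, since \<open>[u, y] y = u y u^-1\<close>; in
    this form it visibly multiplies \<open>x\<close> by \<open>[u, x] = c\<close>.\<close>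
  let ?f = "\<lambda>y. comm G u y \<otimes> y"
  have "?f \<in> hom G G"
    using u by (auto simp: hom_def comm_mult_right m_assoc center_ac comm_center)
  then show ?thesis
    using u by (intro automorphicI[of ?f]) (auto simp: z_nontrivial z_center)
qed

subsection \<open>Transvections\<close>

text \<open>The map is the transvection \<open>x \<mapsto> x - 2dB(x,a)a\<close> on \<open>G/Z\<close>; the quadratic
  correction term absorbs the commutators that arise when the powers of \<open>a\<close> are collected.\<close>
lemma transvection_hom:
  fixes d :: int
  assumes a: "a \<in> carrier G" "a [^] p = \<one>"
  shows "(\<lambda>x. z [^] (d * (B x a)\<^sup>2) \<otimes> (x \<otimes> a [^] (- 2 * d * B x a))) \<in> hom G G"
proof (rule homI)
  fix x y assume x: "x \<in> carrier G" and y: "y \<in> carrier G"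
  define m n where "m = B x a" and "n = B y a"
  have B_xy: "[B (x \<otimes> y) a = m + n] (mod int p)"
    using x y a by (simp add: comm_mult_left comm_eq_B[of x] comm_eq_B[of y] int_pow_mult m_def n_def flip: B_cong_iff)
  have "comm G a y = z [^] (- n)"
    using comm_inverse[OF y a(1)] a y by (simp add: comm_eq_B n_def int_pow_neg)
  then have swap: "a [^] i \<otimes> y = z [^] (- n * i) \<otimes> (y \<otimes> a [^] i)" for i :: int
    using mult_comm_swap[of "a [^] i" y] a y by (simp add: comm_pow_left int_pow_pow)
  define q r c where "q = a [^] (- 2 * d * m)" and "r = a [^] (- 2 * d * n)"
    and "c = z [^] (- n * (- 2 * d * m))"
  have closed: "q \<in> carrier G" "r \<in> carrier G" "c \<in> carrier G" "c \<in> center G"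
    using a by (simp_all add: q_def r_def c_def del: minus_mult_minus mult_minus_left mult_minus_right)
  have qy: "q \<otimes> y = c \<otimes> (y \<otimes> q)"
    unfolding q_def c_def by (rule swap)
  have "z [^] (d * m\<^sup>2) \<otimes> (x \<otimes> q) \<otimes> (z [^] (d * n\<^sup>2) \<otimes> (y \<otimes> r))
      = z [^] (d * m\<^sup>2) \<otimes> (z [^] (d * n\<^sup>2) \<otimes> (x \<otimes> (q \<otimes> y) \<otimes> r))"
    using x y closed by (simp add: m_assoc center_left_commute[of "z [^] (d * n\<^sup>2)"])
  also have "\<dots> = z [^] (d * m\<^sup>2) \<otimes> (z [^] (d * n\<^sup>2) \<otimes> (c \<otimes> (x \<otimes> (y \<otimes> (q \<otimes> r)))))"
    unfolding qy using x y closed by (simp add: m_assoc center_left_commute[of c x])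
  also have "\<dots> = z [^] (d * m\<^sup>2 + d * n\<^sup>2 + - n * (- 2 * d * m)) \<otimes>
      (x \<otimes> y \<otimes> a [^] (- 2 * d * m + - 2 * d * n))"
    unfolding int_pow_mult[OF z_closed] int_pow_mult[OF a(1)] q_def[symmetric] r_def[symmetric]
      c_def[symmetric]
    by (simp only: m_assoc m_closed x y closed z_closed int_pow_closed)
  \<comment> \<open>The cross term \<open>2 d m n\<close> of the square is the exponent of the
    commutator left by moving \<open>q\<close> past \<open>y\<close>. This is what ties the
    coefficient \<open>d\<close> to the factor \<open>-2 d\<close> in the exponent of
    \<open>a\<close>.\<close>
  also have "d * m\<^sup>2 + d * n\<^sup>2 + - n * (- 2 * d * m) = d * (m + n)\<^sup>2"
    by (simp add: power2_eq_square algebra_simps)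
  also have "- 2 * d * m + - 2 * d * n = - 2 * d * (m + n)"
    by (simp add: algebra_simps)
  \<comment> \<open>\<open>B\<close> is additive only modulo \<open>p\<close>; exchanging the
    representatives is harmless because \<open>z\<close> and \<open>a\<close> both have order
    dividing \<open>p\<close>.\<close>
  also have "z [^] (d * (m + n)\<^sup>2) = z [^] (d * (B (x \<otimes> y) a)\<^sup>2)"
    unfolding z_pow_eq_iff by (intro cong_mult cong_pow cong_refl cong_sym[OF B_xy])
  also have "a [^] (- 2 * d * (m + n)) = a [^] (- 2 * d * B (x \<otimes> y) a)"
    by (intro pow_cong a cong_mult cong_refl cong_sym[OF B_xy])
  finally show "z [^] (d * (B (x \<otimes> y) a)\<^sup>2) \<otimes> (x \<otimes> y \<otimes> a [^] (- 2 * d * B (x \<otimes> y) a)) =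
      z [^] (d * (B x a)\<^sup>2) \<otimes> (x \<otimes> a [^] (- 2 * d * B x a)) \<otimes>
      (z [^] (d * (B y a)\<^sup>2) \<otimes> (y \<otimes> a [^] (- 2 * d * B y a)))"
    by (simp only: m_def n_def q_def r_def)
qed (use a in auto)

lemma pow_p_mult: "x \<in> carrier G \<Longrightarrow> y \<in> carrier G \<Longrightarrow> (x \<otimes> y) [^] p = x [^] p \<otimes> y [^] p"
  using pow_p_hom by (simp add: hom_def)

lemma pow_p_int_pow: "x \<in> carrier G \<Longrightarrow> (x [^] (i::int)) [^] p = (x [^] p) [^] i"
  by (simp add: int_pow_pow mult.commute flip: int_pow_int)

text \<open>Equal \<open>p\<close>-th powers give \<open>a = g^-1 h\<close> order dividing
  \<open>p\<close>, so transvections along \<open>a\<close> exist. One of them takes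
  \<open>g\<close> to \<open>g a = h\<close> up to a central factor, provided that
  \<open>[g, a] = [g, h]\<close> is nontrivial.\<close>

lemma automorphic_if_not_commuting:
  assumes g: "g \<in> carrier G" and h: "h \<in> carrier G"
    and "g [^] p = h [^] p" and "comm G g h \<noteq> \<one>"
  shows "automorphic G g h"
proof -
  define a where "a = inv g \<otimes> h"
  have a: "a \<in> carrier G" "a [^] p = \<one>"
    using g h assms(3) by (simp_all add: a_def pow_p_mult nat_pow_inv)
  have ga: "g \<otimes> a = h" using g h by (simp add: a_def flip: m_assoc)
  have "comm G g a = comm G g h"
    using comm_mult_right[of g a g] g a ga by simp
  then have "\<not> int p dvd B g a"
    using assms(4) g a by (metis comm_eq_B z_pow_eq_one_iff)
  moreover have "\<not> int p dvd 2"
    using p_odd p_prime by (metis int_dvd_int_iff of_nat_numeral prime_nat_iff primes_dvd_imp_eq two_is_prime_nat even_numeral)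
  ultimately have "\<not> int p dvd (- 2 * B g a)"
    using p_prime by (simp add: prime_dvd_mult_iff)
  then have "coprime (- 2 * B g a) (int p)"
    by (subst coprime_commute, intro prime_imp_coprime) (use p_prime in auto)
  \<comment> \<open>This \<open>d\<close> makes the exponent of \<open>a\<close> in the image of
    \<open>g\<close> congruent to 1.\<close>
  then obtain d where d: "[- 2 * B g a * d = 1] (mod int p)"
    using cong_solve_coprime_int by blast
  let ?f = "\<lambda>x. z [^] (d * (B x a)\<^sup>2) \<otimes> (x \<otimes> a [^] (- 2 * d * B x a))"
  have Bz: "[B z a = 0] (mod int p)"
    using a z_center by (simp flip: B_cong_iff)
  have "z [^] (d * (B z a)\<^sup>2) = z [^] (0::int)"
    unfolding z_pow_eq_iff using Bz by (simp add: cong_0_iff power2_eq_square)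
  moreover have "a [^] (- 2 * d * B z a) = a [^] (0::int)"
    using Bz by (intro pow_cong a) (simp add: cong_0_iff)
  ultimately have "?f z = z" by simp
  then have "automorphic G g (?f g)"
    using transvection_hom[OF a, of d] z_nontrivial by (intro automorphicI[of ?f]) simp_all
  moreover have "a [^] (- 2 * d * B g a) = a [^] (1::int)"
    using d by (intro pow_cong a) (simp add: mult_ac)
  then have "?f g = z [^] (d * (B g a)\<^sup>2) \<otimes> h"
    using a ga by simp
  \<comment> \<open>The quadratic correction leaves a central factor, which an inner automorphism
    removes.\<close>
  moreover have "automorphic G (z [^] (d * (B g a)\<^sup>2) \<otimes> h) h"
  proof -
    let ?c = "z [^] (d * (B g a)\<^sup>2)"
    have nc: "h \<notin> center G" using assms(4) g by auto
    have "?c \<otimes> h \<notin> center G"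
    proof
      assume "?c \<otimes> h \<in> center G"
      then have "comm G g (?c \<otimes> h) = \<one>" using g by simp
      then show False using assms(4) g h by (simp add: comm_mult_right)
    qed
    then have "automorphic G (?c \<otimes> h) (inv ?c \<otimes> (?c \<otimes> h))"
      using h subgroup.m_inv_closed[OF center_subgroup, of ?c]
      by (intro automorphic_center_mult) auto
    then show ?thesis using h by (simp flip: m_assoc)
  qed
  ultimately show ?thesis using automorphic_trans by metis
qed

text \<open>The intermediate \<open>u\<close> exists because a group is not the union of two proper subgroups.\<close>
lemma automorphic_if_pow_p_eq:
  assumes g: "g \<in> carrier G" and h: "h \<in> carrier G"
    and gh: "g [^] p = h [^] p"
    and a: "a \<in> carrier G" "a [^] p = \<one>" "comm G g a \<noteq> \<one>"
    and b: "b \<in> carrier G" "b [^] p = \<one>" "comm G h b \<noteq> \<one>"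
  shows "automorphic G g h"
proof (cases "comm G g h = \<one>")
  case False
  then show ?thesis using automorphic_if_not_commuting g h gh by blast
next
  case True
  then have hg: "comm G h g = \<one>" using g h by (simp add: comm_eq_one_iff)
  \<comment> \<open>Either \<open>a\<close> or \<open>b\<close> serves as \<open>u\<close>, unless
    \<open>[h, a] = [g, b] = 1\<close>. Then \<open>a b\<close> does, since
    \<open>[g, a b] = [g, a]\<close> and \<open>[h, a b] = [h, b]\<close>.\<close>
  obtain u where u: "u \<in> carrier G" "u [^] p = \<one>" "comm G g u \<noteq> \<one>" "comm G h u \<noteq> \<one>"
  proof (cases "comm G h a = \<one> \<and> comm G g b = \<one>")
    case True
    then show thesis
      using that[of "a \<otimes> b"] g h a b by (simp add: comm_mult_right pow_p_mult)
  qed (use that a b in blast)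
  \<comment> \<open>The path is \<open>g\<close>, \<open>g u\<close>, \<open>h\<close>: all three
    have the same \<open>p\<close>-th power, while \<open>[g, g u] = [g, u]\<close> and
    \<open>[g u, h] = [u, h]\<close> are nontrivial.\<close>
  have "automorphic G g (g \<otimes> u)"
    using g u by (intro automorphic_if_not_commuting) (simp_all add: pow_p_mult comm_mult_right)
  moreover have "comm G (g \<otimes> u) h \<noteq> \<one>"
    using u g h True by (simp add: comm_mult_left) (simp add: comm_eq_one_iff)
  then have "automorphic G (g \<otimes> u) h"
    using g h u gh by (intro automorphic_if_not_commuting) (simp_all add: pow_p_mult)
  ultimately show ?thesis by (rule automorphic_trans)
qed

end

lemma (in group) commute_int_pow:
  assumes "x \<in> carrier G" "y \<in> carrier G" "x \<otimes> y = y \<otimes> x"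
  shows "x \<otimes> y [^] (i::int) = y [^] i \<otimes> x"
proof -
  have "(\<lambda>u. x \<otimes> u \<otimes> inv x) \<in> hom G G"
    by (rule homI) (use assms in \<open>simp_all add: m_assoc inv_solve_left\<close>)
  then have "x \<otimes> y [^] i \<otimes> inv x = (x \<otimes> y \<otimes> inv x) [^] i"
    using assms(2) by (rule hom_pow(2))
  also have "x \<otimes> y \<otimes> inv x = y"
    using assms by (simp add: m_assoc)
  finally show ?thesis
    using assms by (simp add: inv_solve_right')
qed

context cyclic_center_class2
begin

subsection \<open>Hyperbolic splitting\<close>

text \<open>Preimages of the subspaces of \<open>G/Z\<close> on which the commutator form is
  nondegenerate; equivalently, subgroups over \<open>Z\<close> whose own center is
  \<open>Z\<close>.\<close>

definition nondegenerate :: "'a set \<Rightarrow> bool" where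
  "nondegenerate H \<longleftrightarrow> subgroup H G \<and> center G \<subseteq> H \<and>
     (\<forall>x\<in>H. (\<forall>y\<in>H. comm G x y = \<one>) \<longrightarrow> x \<in> center G)"

text \<open>The orthogonal complement in \<open>H\<close> of the plane spanned by \<open>v\<close>
  and \<open>w\<close>.\<close>

definition perp :: "'a set \<Rightarrow> 'a \<Rightarrow> 'a \<Rightarrow> 'a set" where
  "perp H v w = {x \<in> H. comm G x v = \<one> \<and> comm G x w = \<one>}"

lemma nondegenerate_carrier: "nondegenerate (carrier G)"
  unfolding nondegenerate_def using centerI center_closed subgroup_self by blast

lemma nondegenerate_closed: "nondegenerate H \<Longrightarrow> x \<in> H \<Longrightarrow> x \<in> carrier G"
  unfolding nondegenerate_def using subgroup.mem_carrier by metis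

text \<open>Take noncommuting \<open>x\<close> and \<open>y\<close>. If \<open>x^p\<close> is
  nontrivial it generates the center, so multiplying \<open>y\<close> by a power of \<open>x\<close>
  kills its \<open>p\<close>-th power without changing \<open>[x, y]\<close>. With
  \<open>w^p = 1\<close>, powers of \<open>w\<close> depend only on the exponent modulo
  \<open>p\<close>.\<close>

lemma hyperbolic_pair:
  assumes H: "nondegenerate H" and "H \<noteq> center G"
  obtains v w where "v \<in> H" "w \<in> H" "w [^] p = \<one>" "comm G v w = z"
proof -
  have sub: "subgroup H G" using H by (simp add: nondegenerate_def)
  note closed = nondegenerate_closed[OF H]
  obtain x y where xy: "x \<in> H" "y \<in> H" "comm G y x \<noteq> \<one>"
    using assms closed unfolding nondegenerate_def by (metis comm_eq_one_iff subsetI subset_antisym)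
  obtain w u where w: "w \<in> H" "w [^] p = \<one>" and u: "u \<in> H" "comm G u w \<noteq> \<one>"
  proof (cases "x [^] p = \<one>")
    case True
    then show thesis using that xy by blast
  next
    case False
    obtain m :: int where m: "y [^] p = (x [^] p) [^] m"
      using center_generator[OF pow_p_center False pow_p_center] xy closed by metis
    define w where "w = y \<otimes> x [^] (- m)"
    have "w [^] p = \<one>"
      using xy closed m by (simp add: w_def pow_p_mult pow_p_int_pow flip: int_pow_mult)
    moreover have "comm G x w \<noteq> \<one>"
      using xy closed by (simp add: w_def comm_mult_right comm_pow_right) (simp add: comm_eq_one_iff)
    moreover have "w \<in> H"
      unfolding w_def using xy sub by (intro subgroup.m_closed subgroup_int_pow_closed)
    ultimately show thesis using that xy by blast
  qed
  obtain v where "v \<in> H" "comm G v w = z"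
    using commutator_surj[OF sub u(1) closed[OF w(1)] u(2) z_center] .
  then show thesis using that w by blast
qed

text \<open>As \<open>[v, w] = z\<close> and \<open>[w, v] = z^-1\<close>, the coordinates of
  \<open>x\<close> along \<open>v\<close> and \<open>w\<close> are \<open>B x w\<close> and
  \<open>- B x v\<close>. Dividing them out leaves an orthogonal remainder.\<close>

lemma perp_decomposition:
  assumes H: "nondegenerate H" and v: "v \<in> H" and w: "w \<in> H" and vw: "comm G v w = z"
    and x: "x \<in> H"
  defines "h \<equiv> w [^] B x v \<otimes> (v [^] (- B x w) \<otimes> x)"
  shows "h \<in> perp H v w" and "x = v [^] B x w \<otimes> (w [^] (- B x v) \<otimes> h)"
proof -
  have sub: "subgroup H G" using H by (simp add: nondegenerate_def)
  note closed = nondegenerate_closed[OF H v] nondegenerate_closed[OF H w] nondegenerate_closed[OF H x]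
  have wv: "comm G w v = z [^] (- 1 :: int)"
    using comm_inverse[OF closed(1,2)] vw by (simp add: int_pow_neg)
  have "h \<in> H"
    unfolding h_def using sub v w x by (intro subgroup.m_closed subgroup_int_pow_closed)
  moreover have "comm G h v = \<one>"
    using closed wv
    by (simp add: h_def comm_mult_left comm_pow_left comm_eq_B[of x] int_pow_pow flip: int_pow_mult)
  moreover have "comm G h w = \<one>"
    using closed vw
    by (simp add: h_def comm_mult_left comm_pow_left comm_eq_B[of x] flip: int_pow_mult)
  ultimately show "h \<in> perp H v w" by (simp add: perp_def)
  show "x = v [^] B x w \<otimes> (w [^] (- B x v) \<otimes> h)"
    using closed by (simp add: h_def int_pow_neg) (simp flip: m_assoc)
qed

lemma perp_normal_form:
  assumes "nondegenerate H" "v \<in> H" "w \<in> H" "comm G v w = z" "x \<in> H"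
  obtains i j :: int and h where "h \<in> perp H v w" "x = v [^] i \<otimes> (w [^] j \<otimes> h)"
  using perp_decomposition[OF assms] by blast

text \<open>\<open>H\<close> is generated by \<open>v\<close>, \<open>w\<close> and the complement,
  so an element of the complement that is orthogonal to the complement is orthogonal to all of
  \<open>H\<close>.\<close>

lemma perp_nondegenerate:
  assumes H: "nondegenerate H" and v: "v \<in> H" and w: "w \<in> H" and vw: "comm G v w = z"
  shows "nondegenerate (perp H v w)" and "perp H v w \<subset> H"
proof -
  have sub: "subgroup H G" using H by (simp add: nondegenerate_def)
  note closed = nondegenerate_closed[OF H]
  have "subgroup (perp H v w) G"
  proof (rule subgroupI)
    show "perp H v w \<subseteq> carrier G" using closed by (auto simp: perp_def)
    have "\<one> \<in> perp H v w"
      using subgroup.one_closed[OF sub] subgroup.one_closed[OF center_subgroup] v w closed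
      by (simp add: perp_def)
    then show "perp H v w \<noteq> {}" by blast
  next
    fix a assume "a \<in> perp H v w"
    then show "inv a \<in> perp H v w"
      using subgroup.m_inv_closed[OF sub] v w closed comm_pow_left(2)[of a _ "- 1"]
      by (auto simp: perp_def int_pow_neg)
  next
    fix a b assume "a \<in> perp H v w" "b \<in> perp H v w"
    then show "a \<otimes> b \<in> perp H v w"
      using subgroup.m_closed[OF sub] v w closed by (auto simp: perp_def comm_mult_left)
  qed
  moreover have "center G \<subseteq> perp H v w"
    using H v w closed by (auto simp: perp_def nondegenerate_def)
  moreover have "x \<in> center G"
    if x: "x \<in> perp H v w" and xperp: "\<And>y. y \<in> perp H v w \<Longrightarrow> comm G x y = \<one>" for x
  proof -
    have xH: "x \<in> H" "comm G x v = \<one>" "comm G x w = \<one>" using x by (auto simp: perp_def)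
    have "comm G x y = \<one>" if y: "y \<in> H" for y
    proof -
      obtain i j h where h: "h \<in> perp H v w" "y = v [^] (i::int) \<otimes> (w [^] (j::int) \<otimes> h)"
        using perp_normal_form[OF H v w vw y] .
      have hH: "h \<in> H" using h(1) by (simp add: perp_def)
      show ?thesis
        unfolding h(2) using xH xperp[OF h(1)] closed[OF xH(1)] closed[OF v] closed[OF w] closed[OF hH]
        by (simp add: comm_mult_right comm_pow_right)
    qed
    then show ?thesis using H xH(1) unfolding nondegenerate_def by blast
  qed
  ultimately show "nondegenerate (perp H v w)" unfolding nondegenerate_def by blast
  have "v \<notin> perp H v w" using vw z_nontrivial by (simp add: perp_def)
  then show "perp H v w \<subset> H" using v by (auto simp: perp_def)
qed

text \<open>Symplectic Gram-Schmidt as an induction rule: it serves both the duality and the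
  construction of similitudes.\<close>

lemma nondegenerate_induct [consumes 1, case_names center perp]:
  assumes "nondegenerate H"
    and center: "P (center G)"
    and perp: "\<And>H v w. nondegenerate H \<Longrightarrow> v \<in> H \<Longrightarrow> w \<in> H \<Longrightarrow> w [^] p = \<one> \<Longrightarrow>
      comm G v w = z \<Longrightarrow> P (perp H v w) \<Longrightarrow> P H"
  shows "P H"
  using assms(1)
proof (induction "card H" arbitrary: H rule: less_induct)
  case less
  show ?case
  proof (cases "H = center G")
    case False
    obtain v w where vw: "v \<in> H" "w \<in> H" "w [^] p = \<one>" "comm G v w = z"
      using hyperbolic_pair[OF less.prems False] .
    have "finite H"
      using nondegenerate_closed[OF less.prems] finite_carrier by (meson finite_subset subsetI)
    then have "card (perp H v w) < card H"
      using perp_nondegenerate(2)[OF less.prems vw(1,2,4)] by (rule psubset_card_mono)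
    then show ?thesis
      using less perp vw perp_nondegenerate(1)[OF less.prems vw(1,2,4)] by blast
  qed (simp add: center)
qed

text \<open>The form identifies the space with its dual.\<close>
lemma center_valued_hom_eq_comm:
  assumes "nondegenerate H"
    and "\<And>x. x \<in> H \<Longrightarrow> \<chi> x \<in> center G"
    and "\<And>x y. x \<in> H \<Longrightarrow> y \<in> H \<Longrightarrow> \<chi> (x \<otimes> y) = \<chi> x \<otimes> \<chi> y"
    and "\<And>c. c \<in> center G \<Longrightarrow> \<chi> c = \<one>"
  shows "\<exists>u\<in>H. \<forall>x\<in>H. \<chi> x = comm G x u"
  using assms
proof (induction rule: nondegenerate_induct)
  case center
  then show ?case
    using center_closed subgroup.one_closed[OF center_subgroup] by (intro bexI[of _ \<one>]) auto
next
  case (perp H v w)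
  note H = perp.hyps(1) and v = perp.hyps(2) and w = perp.hyps(3) and vw = perp.hyps(5)
  note \<chi> = perp.prems
  have sub: "subgroup H G" using H by (simp add: nondegenerate_def)
  note closed = nondegenerate_closed[OF H]
  have "\<exists>u\<in>perp H v w. \<forall>x\<in>perp H v w. \<chi> x = comm G x u"
    by (rule perp.IH) (use \<chi> in \<open>auto simp: perp_def\<close>)
  then obtain u where u: "u \<in> perp H v w" "\<And>x. x \<in> perp H v w \<Longrightarrow> \<chi> x = comm G x u"
    by blast
  have uH: "u \<in> H" using u(1) by (simp add: perp_def)
  obtain a b where ab: "\<chi> v = z [^] (a::int)" "\<chi> w = z [^] (b::int)"
    using \<chi>(1) v w centerE by metis
  \<comment> \<open>The exponents solve \<open>[v, t] = [v, w]^a = z^a\<close> and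
    \<open>[w, t] = [w, v]^(-b) = z^b\<close>, while \<open>u\<close> contributes nothing on the
    plane.\<close>
  define t where "t = u \<otimes> (v [^] (- b) \<otimes> w [^] a)"
  have t: "t \<in> H"
    unfolding t_def using sub uH v w by (intro subgroup.m_closed subgroup_int_pow_closed)
  have wv: "comm G w v = z [^] (- 1 :: int)"
    using comm_inverse[of v w] closed[OF v] closed[OF w] vw by (simp add: int_pow_neg)
  have "comm G u v = \<one>" "comm G u w = \<one>" using u(1) by (auto simp: perp_def)
  then have vu: "comm G v u = \<one>" "comm G w u = \<one>"
    using closed uH v w by (simp_all add: comm_eq_one_iff)
  have "\<chi> v = comm G v t"
    using ab(1) vw vu closed uH v w by (simp add: t_def comm_mult_right comm_pow_right)
  moreover have "\<chi> w = comm G w t"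
    using ab(2) wv vu closed uH v w
    by (simp add: t_def comm_mult_right comm_pow_right int_pow_pow)
  moreover have "\<chi> h = comm G h t" if "h \<in> perp H v w" for h
    using that u(2)[OF that] closed uH v w
    by (simp add: t_def comm_mult_right comm_pow_right perp_def)
  \<comment> \<open>Both sides are homomorphisms on \<open>H\<close>, so their equalizer is a
    subgroup; it contains \<open>v\<close>, \<open>w\<close> and the complement, hence all of
    \<open>H\<close>.\<close>
  moreover define S where "S = {x \<in> H. \<chi> x = comm G x t}"
  ultimately have S: "v \<in> S" "w \<in> S" "perp H v w \<subseteq> S"
    using v w by (auto simp: perp_def)
  have \<chi>_inv: "\<chi> (inv x) = inv (\<chi> x)" if x: "x \<in> H" for x
  proof -
    have "\<chi> (inv x) \<otimes> \<chi> x = \<chi> (inv x \<otimes> x)"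
      using \<chi>(2) subgroup.m_inv_closed[OF sub x] x by simp
    also have "\<dots> = \<one>"
      using \<chi>(3) subgroup.one_closed[OF center_subgroup] closed[OF x] by simp
    finally show ?thesis
      using \<chi>(1) x subgroup.m_inv_closed[OF sub x] center_closed inv_equality by metis
  qed
  have S_sub: "subgroup S G"
  proof (rule subgroupI)
    show "S \<subseteq> carrier G" using closed by (auto simp: S_def)
    show "S \<noteq> {}" using S by blast
  next
    fix x assume "x \<in> S"
    then show "inv x \<in> S"
      using subgroup.m_inv_closed[OF sub] \<chi>_inv comm_pow_left(2)[of x t "- 1"] closed t
      by (auto simp: S_def int_pow_neg)
  next
    fix x y assume "x \<in> S" "y \<in> S"
    then show "x \<otimes> y \<in> S"
      using subgroup.m_closed[OF sub] \<chi>(2) closed t by (auto simp: S_def comm_mult_left)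
  qed
  have "x \<in> S" if x: "x \<in> H" for x
  proof -
    obtain i j h where h: "h \<in> perp H v w" and x: "x = v [^] (i::int) \<otimes> (w [^] (j::int) \<otimes> h)"
      using perp_normal_form[OF H v w vw x] .
    have "h \<in> S" using h S by blast
    then show ?thesis
      unfolding x using S S_sub by (intro subgroup.m_closed subgroup_int_pow_closed)
  qed
  then show ?case using t by (auto simp: S_def)
qed

text \<open>Since \<open>h\<close> commutes with \<open>v\<close> and \<open>w\<close>, the only
  commutator arises from moving \<open>w^j\<close> past \<open>v^i'\<close>.\<close>

lemma normal_form_mult:
  fixes i j i' j' :: int
  assumes v: "v \<in> carrier G" and w: "w \<in> carrier G" and h: "h \<in> carrier G" and h': "h' \<in> carrier G"
    and hv: "comm G h v = \<one>" and hw: "comm G h w = \<one>"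
  shows "(v [^] i \<otimes> (w [^] j \<otimes> h)) \<otimes> (v [^] i' \<otimes> (w [^] j' \<otimes> h'))
    = v [^] (i + i') \<otimes> (w [^] (j + j') \<otimes> (comm G (w [^] j) (v [^] i') \<otimes> (h \<otimes> h')))"
proof -
  define c where "c = comm G (w [^] j) (v [^] i')"
  have c: "c \<in> center G" "c \<in> carrier G" using v w by (simp_all add: c_def comm_center)
  have hv': "h \<otimes> v [^] i' = v [^] i' \<otimes> h" and hw': "h \<otimes> w [^] j' = w [^] j' \<otimes> h"
    using h v w hv hw by (simp_all add: commute_int_pow comm_eq_one_iff)
  have wv: "w [^] j \<otimes> v [^] i' = c \<otimes> (v [^] i' \<otimes> w [^] j)"
    unfolding c_def using v w by (intro mult_comm_swap) auto
  have "(v [^] i \<otimes> (w [^] j \<otimes> h)) \<otimes> (v [^] i' \<otimes> (w [^] j' \<otimes> h'))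
      = v [^] i \<otimes> (w [^] j \<otimes> ((h \<otimes> v [^] i') \<otimes> (w [^] j' \<otimes> h')))"
    using v w h h' by (simp add: m_assoc)
  also have "\<dots> = v [^] i \<otimes> ((w [^] j \<otimes> v [^] i') \<otimes> ((h \<otimes> w [^] j') \<otimes> h'))"
    unfolding hv' using v w h h' by (simp add: m_assoc)
  also have "\<dots> = (v [^] i \<otimes> v [^] i') \<otimes> ((w [^] j \<otimes> w [^] j') \<otimes> (c \<otimes> (h \<otimes> h')))"
    unfolding hw' wv using v w h h' c by (simp add: m_assoc center_left_commute[of c])
  finally show ?thesis
    using v w by (simp add: c_def int_pow_mult)
qed

text \<open>The map is \<open>v -> v^k\<close>, \<open>w -> w\<close> on a hyperbolic plane,
  continued inductively on the complement; on the center, where the induction starts, it is the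
  \<open>k\<close>-th power. It multiplies the form by \<open>k\<close>.\<close>

lemma multiplier_endomorphism:
  fixes k :: int
  assumes "nondegenerate H"
  shows "\<exists>\<phi>. (\<forall>x\<in>H. \<phi> x \<in> H) \<and> (\<forall>x\<in>H. \<forall>y\<in>H. \<phi> (x \<otimes> y) = \<phi> x \<otimes> \<phi> y) \<and>
    (\<forall>c\<in>center G. \<phi> c = c [^] k)"
  using assms
proof (induction rule: nondegenerate_induct)
  case center
  show ?case
    using subgroup_int_pow_closed[OF center_subgroup] center_closed center_commute
    by (intro exI[of _ "\<lambda>x. x [^] k"]) (auto intro!: int_pow_mult_distrib)
next
  case (perp H v w)
  note H = perp.hyps(1) and v = perp.hyps(2) and w = perp.hyps(3) and wp = perp.hyps(4)
    and vw = perp.hyps(5)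
  have sub: "subgroup H G" using H by (simp add: nondegenerate_def)
  note closed = nondegenerate_closed[OF H]
  obtain \<psi> where \<psi>: "\<And>x. x \<in> perp H v w \<Longrightarrow> \<psi> x \<in> perp H v w"
    "\<And>x y. x \<in> perp H v w \<Longrightarrow> y \<in> perp H v w \<Longrightarrow> \<psi> (x \<otimes> y) = \<psi> x \<otimes> \<psi> y"
    "\<And>c. c \<in> center G \<Longrightarrow> \<psi> c = c [^] k"
    using perp.IH by blast
  have perp_sub: "subgroup (perp H v w) G" and center_perp: "center G \<subseteq> perp H v w"
    using perp_nondegenerate(1)[OF H v w vw] by (auto simp: nondegenerate_def)
  have perpD: "h \<in> H" "h \<in> carrier G" "comm G h v = \<one>" "comm G h w = \<one>"
    if "h \<in> perp H v w" for h
    using that closed by (auto simp: perp_def)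
  have vwc: "v \<in> carrier G" "w \<in> carrier G" using closed v w by auto
  have wv: "comm G w v = z [^] (- 1 :: int)"
    using comm_inverse[of v w] vwc vw by (simp add: int_pow_neg)
  \<comment> \<open>The coordinates are read off with \<open>B\<close>, so they are arbitrary
    representatives modulo \<open>p\<close>; \<open>\<phi>_eq\<close> shows that any other integer
    coordinates give the same value.\<close>
  define \<phi> where "\<phi> x = v [^] (k * B x w) \<otimes> (w [^] (- B x v) \<otimes>
    \<psi> (w [^] B x v \<otimes> (v [^] (- B x w) \<otimes> x)))" for x
  have \<phi>_eq: "\<phi> (v [^] i \<otimes> (w [^] j \<otimes> h)) = v [^] (k * i) \<otimes> (w [^] j \<otimes> \<psi> h)"
    if h: "h \<in> perp H v w" for i j :: int and h
  proof -
    define x where "x = v [^] i \<otimes> (w [^] j \<otimes> h)"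
    have x: "x \<in> carrier G" using vwc perpD[OF h] by (simp add: x_def)
    have "comm G x w = z [^] i"
      using vwc perpD[OF h] vw by (simp add: x_def comm_mult_left comm_pow_left)
    then have "[B x w = i] (mod int p)"
      using x vwc by (simp add: B_cong_iff)
    then obtain s where s: "i = B x w + int p * s"
      by (auto simp: cong_iff_lin)
    have "comm G x v = z [^] (- j)"
      using vwc perpD[OF h] wv by (simp add: x_def comm_mult_left comm_pow_left int_pow_pow)
    then have "[B x v = - j] (mod int p)"
      using x vwc by (simp add: B_cong_iff)
    then have j: "[- B x v = j] (mod int p)" "[B x v + j = 0] (mod int p)"
      by (simp_all add: cong_iff_dvd_diff dvd_diff_commute[of _ _ j] add.commute)
    \<comment> \<open>\<open>v^p\<close> need not be trivial, so changing the exponent of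
      \<open>v\<close> by \<open>p s\<close> costs this central element. It moves into the
      complement, where \<open>\<psi>\<close> raises it to the power \<open>k\<close>, matching the
      change of \<open>v^(k i)\<close>.\<close>
    define c where "c = (v [^] p) [^] s"
    have c: "c \<in> center G"
      unfolding c_def using pow_p_center vwc by (intro subgroup_int_pow_closed center_subgroup) auto
    have c_perp: "c \<in> perp H v w" using c center_perp by blast
    have cc: "c \<in> carrier G" using c center_closed by blast
    have v_c: "v [^] (int p * s) = c"
      using vwc by (simp add: c_def int_pow_pow flip: int_pow_int)
    have "w [^] B x v \<otimes> (v [^] (- B x w) \<otimes> x)
        = w [^] B x v \<otimes> ((v [^] (- B x w) \<otimes> v [^] i) \<otimes> (w [^] j \<otimes> h))"
      using vwc perpD[OF h] by (simp add: x_def m_assoc)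
    also have "v [^] (- B x w) \<otimes> v [^] i = c"
      using vwc s v_c by (simp flip: int_pow_mult)
    also have "w [^] B x v \<otimes> (c \<otimes> (w [^] j \<otimes> h)) = c \<otimes> ((w [^] B x v \<otimes> w [^] j) \<otimes> h)"
      using vwc perpD[OF h] cc c by (simp add: m_assoc center_left_commute[of c])
    also have "w [^] B x v \<otimes> w [^] j = \<one>"
      using pow_cong[OF vwc(2) wp j(2)] vwc by (simp flip: int_pow_mult)
    also have "c \<otimes> (\<one> \<otimes> h) = c \<otimes> h" using perpD[OF h] by simp
    finally have "\<phi> x = v [^] (k * B x w) \<otimes> (w [^] (- B x v) \<otimes> (c [^] k \<otimes> \<psi> h))"
      using \<psi>(2)[OF c_perp h] \<psi>(3)[OF c] by (simp add: \<phi>_def)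
    also have "w [^] (- B x v) = w [^] j"
      by (rule pow_cong[OF vwc(2) wp j(1)])
    also have "v [^] (k * B x w) \<otimes> (w [^] j \<otimes> (c [^] k \<otimes> \<psi> h))
        = (v [^] (k * B x w) \<otimes> c [^] k) \<otimes> (w [^] j \<otimes> \<psi> h)"
      using vwc perpD[OF \<psi>(1)[OF h]] cc subgroup_int_pow_closed[OF center_subgroup c]
      by (simp add: m_assoc center_left_commute[of "c [^] k"])
    also have "v [^] (k * B x w) \<otimes> c [^] k = v [^] (k * i)"
      using vwc by (simp add: s v_c[symmetric] int_pow_pow algebra_simps flip: int_pow_mult)
    finally show ?thesis by (simp add: x_def)
  qed
  have "\<phi> x \<in> H" if x: "x \<in> H" for x
  proof -
    obtain i j h where h: "h \<in> perp H v w" and x: "x = v [^] (i::int) \<otimes> (w [^] (j::int) \<otimes> h)"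
      using perp_normal_form[OF H v w vw x] .
    show ?thesis
      unfolding x \<phi>_eq[OF h] using sub v w perpD(1)[OF \<psi>(1)[OF h]]
      by (intro subgroup.m_closed subgroup_int_pow_closed)
  qed
  moreover have "\<phi> (x \<otimes> y) = \<phi> x \<otimes> \<phi> y" if x: "x \<in> H" and y: "y \<in> H" for x y
  proof -
    obtain i j h where h: "h \<in> perp H v w" and x: "x = v [^] (i::int) \<otimes> (w [^] (j::int) \<otimes> h)"
      using perp_normal_form[OF H v w vw x] .
    obtain i' j' h' where h': "h' \<in> perp H v w"
      and y: "y = v [^] (i'::int) \<otimes> (w [^] (j'::int) \<otimes> h')"
      using perp_normal_form[OF H v w vw y] .
    define c where "c = comm G (w [^] j) (v [^] i')"
    have c: "c \<in> center G" using vwc by (simp add: c_def comm_center)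
    \<comment> \<open>Scaling \<open>v\<close> alone raises the commutator of the normal form to the
      power \<open>k\<close>, exactly as \<open>\<psi>\<close> does on the center.\<close>
    have c': "comm G (w [^] j) (v [^] (k * i')) = c [^] k"
      using vwc by (simp add: c_def comm_pow_right int_pow_pow mult.commute)
    have hh': "h \<otimes> h' \<in> perp H v w" using perp_sub h h' by (rule subgroup.m_closed)
    have chh': "c \<otimes> (h \<otimes> h') \<in> perp H v w"
      using perp_sub c center_perp hh' by (blast intro: subgroup.m_closed)
    have "x \<otimes> y = v [^] (i + i') \<otimes> (w [^] (j + j') \<otimes> (c \<otimes> (h \<otimes> h')))"
      unfolding x y c_def using vwc perpD[OF h] perpD[OF h'] by (intro normal_form_mult)
    then have "\<phi> (x \<otimes> y) = v [^] (k * (i + i')) \<otimes> (w [^] (j + j') \<otimes> \<psi> (c \<otimes> (h \<otimes> h')))"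
      using \<phi>_eq[OF chh'] by simp
    also have "\<psi> (c \<otimes> (h \<otimes> h')) = c [^] k \<otimes> (\<psi> h \<otimes> \<psi> h')"
      using \<psi>(2)[OF _ hh'] \<psi>(2)[OF h h'] \<psi>(3)[OF c] c center_perp by auto
    also have "v [^] (k * (i + i')) \<otimes> (w [^] (j + j') \<otimes> (c [^] k \<otimes> (\<psi> h \<otimes> \<psi> h')))
      = (v [^] (k * i) \<otimes> (w [^] j \<otimes> \<psi> h)) \<otimes> (v [^] (k * i') \<otimes> (w [^] j' \<otimes> \<psi> h'))"
      using vwc perpD[OF \<psi>(1)[OF h]] perpD[OF \<psi>(1)[OF h']]
      by (subst normal_form_mult) (simp_all add: c' distrib_left)
    also have "\<dots> = \<phi> x \<otimes> \<phi> y"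
      by (simp add: x y \<phi>_eq h h')
    finally show ?thesis .
  qed
  moreover have "\<phi> c = c [^] k" if c: "c \<in> center G" for c
    using \<phi>_eq[of c 0 0] c center_perp center_closed[OF c] \<psi>(3)[OF c] by auto
  ultimately show ?case by blast
qed

text \<open>The multiplier is a \<open>k\<close> with \<open>d = c^k\<close>. As \<open>c\<close> is
  a power of \<open>z\<close>, killing \<open>z\<close> would kill \<open>c\<close>, so
  \<open>hom_iso\<close> applies.\<close>

lemma multiplier_automorphism:
  assumes "c \<in> center G" "c \<noteq> \<one>" "d \<in> center G" "d \<noteq> \<one>"
  obtains \<phi> where "\<phi> \<in> iso G G" "\<phi> c = d"
proof -
  obtain k :: int where k: "d = c [^] k" using center_generator assms by metis
  obtain m :: int where m: "c = z [^] m" using centerE assms(1) .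
  obtain \<phi> where \<phi>: "\<phi> \<in> carrier G \<rightarrow> carrier G"
    "\<And>x y. x \<in> carrier G \<Longrightarrow> y \<in> carrier G \<Longrightarrow> \<phi> (x \<otimes> y) = \<phi> x \<otimes> \<phi> y"
    "\<And>c. c \<in> center G \<Longrightarrow> \<phi> c = c [^] k"
    using multiplier_endomorphism[OF nondegenerate_carrier, of k] by blast
  have hom: "\<phi> \<in> hom G G" using \<phi> by (auto simp: hom_def)
  have "\<phi> z \<noteq> \<one>"
  proof
    assume "\<phi> z = \<one>"
    then have "\<phi> c = \<one>" using hom by (simp add: m hom_pow)
    then show False using assms \<phi>(3) k by simp
  qed
  then show thesis using that hom_iso[OF hom] \<phi>(3) assms(1) k by auto
qed

end

section \<open>Invariants of automorphisms\<close>

lemma (in group) ord_eq_iff_pow: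
  assumes "x \<in> carrier G" "y \<in> carrier G"
    and "\<And>n::nat. x [^] n = \<one> \<longleftrightarrow> y [^] n = \<one>"
  shows "ord x = ord y"
  using assms by (metis dvd_antisym pow_eq_id pow_ord_eq_1)

lemma (in group) iso_one_iff:
  assumes "\<phi> \<in> iso G G" "x \<in> carrier G"
  shows "\<phi> x = \<one> \<longleftrightarrow> x = \<one>"
proof -
  have "inj_on \<phi> (carrier G)" "\<phi> \<one> = \<one>"
    using assms(1) hom_one[OF _ is_group is_group, of \<phi>] by (auto simp: iso_def bij_betw_def)
  then show ?thesis using assms(2) by (metis inj_onD one_closed)
qed

lemma (in group) automorphic_pow_eq_one_iff:
  assumes "automorphic G g h" "g \<in> carrier G"
  shows "g [^] (n::nat) = \<one> \<longleftrightarrow> h [^] n = \<one>"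
proof -
  obtain \<phi> where \<phi>: "\<phi> \<in> iso G G" "h = \<phi> g" using assms(1) by (auto simp: automorphic_def)
  then have "\<phi> (g [^] n) = h [^] n"
    using assms(2) by (simp add: hom_pow iso_imp_homomorphism)
  then show ?thesis using iso_one_iff[OF \<phi>(1), of "g [^] n"] assms(2) by simp
qed

lemma (in group) automorphic_closed:
  "automorphic G g h \<Longrightarrow> g \<in> carrier G \<Longrightarrow> h \<in> carrier G"
  by (auto simp: automorphic_def iso_def hom_def)

lemma (in group) automorphic_center_iff:
  assumes "automorphic G g h" "g \<in> carrier G"
  shows "g \<in> center G \<longleftrightarrow> h \<in> center G"
proof -
  obtain \<phi> where \<phi>: "\<phi> \<in> iso G G" "h = \<phi> g" using assms(1) by (auto simp: automorphic_def)
  have hom: "\<phi> \<in> hom G G" using \<phi>(1) by (rule iso_imp_homomorphism)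
  have surj: "\<phi> ` carrier G = carrier G" using \<phi>(1) by (simp add: iso_def bij_betw_def)
  have h: "h \<in> carrier G" using assms by (rule automorphic_closed)
  have center_iff: "x \<in> center G \<longleftrightarrow> (\<forall>y\<in>carrier G. comm G x y = \<one>)" if "x \<in> carrier G" for x
    using that unfolding center_def by (auto simp: comm_eq_one_iff)
  have "comm G g y = \<one> \<longleftrightarrow> comm G h (\<phi> y) = \<one>" if "y \<in> carrier G" for y
    using hom_comm[OF hom assms(2) that] iso_one_iff[OF \<phi>(1), of "comm G g y"] that assms(2) \<phi>(2)
    by simp
  then have "(\<forall>y\<in>carrier G. comm G g y = \<one>) \<longleftrightarrow> (\<forall>y\<in>\<phi> ` carrier G. comm G h y = \<one>)"
    by blast
  then show ?thesis using assms(2) h surj center_iff by simp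
qed

lemma (in group) aut_orbits_eq:
  "aut_orbits G = (\<lambda>g. {h. automorphic G g h}) ` carrier G"
proof -
  have "{\<phi> g |\<phi>. \<phi> \<in> iso G G} = {h. automorphic G g h}" for g
    by (auto simp: automorphic_def)
  then show ?thesis by (simp add: aut_orbits_def)
qed

section \<open>Cosets of the center and the \<open>p\<close>-th power map in coordinates\<close>

context cyclic_center_class2
begin

lemma center_coset_iff:
  assumes "x \<in> carrier G" "y \<in> carrier G"
  shows "center G #> x = center G #> y \<longleftrightarrow> x \<in> center G #> y"
  using assms rcos_self[OF _ center_subgroup] repr_independence[OF _ _ center_subgroup] by metis

lemma center_cosetE:
  assumes "x \<in> center G #> y" obtains c where "c \<in> center G" "x = c \<otimes> y"
  using assms by (auto simp: r_coset_def)

lemma center_coset_closed: "x \<in> center G #> y \<Longrightarrow> y \<in> carrier G \<Longrightarrow> x \<in> carrier G"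
  using center_closed by (auto simp: r_coset_def)

lemma center_normal: "center G \<lhd> G"
  unfolding normal_inv_iff
proof (intro conjI center_subgroup ballI)
  fix x h assume x: "x \<in> carrier G" and h: "h \<in> center G"
  then have "x \<otimes> h \<otimes> inv x = h"
    using center_closed[OF h] by (simp flip: center_commute[OF h]) (simp add: m_assoc)
  then show "x \<otimes> h \<otimes> inv x \<in> center G" using h by simp
qed

text \<open>Reduces an identity between homomorphisms on \<open>G\<close> to the center and the
  basis vectors: each coset is a product of cosets of elements of \<open>S\<close>, and
  \<open>S\<close> absorbs the center.\<close>

lemma V_basis_generates:
  assumes basis: "is_V_basis p G n v w" and S: "subgroup S G" "center G \<subseteq> S"
    and vw: "\<And>i. i \<in> {1..n} \<Longrightarrow> v i \<in> S \<and> w i \<in> S"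
  shows "S = carrier G"
proof -
  let ?Q = "G Mod center G"
  interpret N: normal "center G" G by (rule center_normal)
  \<comment> \<open>\<open>finprod\<close> behaves as a product only in a commutative monoid; here
    commutativity holds because commutators are central.\<close>
  interpret Q: comm_group ?Q
  proof (rule group.group_comm_groupI[OF N.factorgroup_is_group])
    fix U T assume "U \<in> carrier ?Q" "T \<in> carrier ?Q"
    then obtain x y where xy: "x \<in> carrier G" "y \<in> carrier G" "U = center G #> x" "T = center G #> y"
      by (auto simp: carrier_FactGroup)
    have "x \<otimes> y \<in> center G #> (y \<otimes> x)"
      using mult_comm_swap[OF xy(1,2)] comm_center[OF xy(1,2)] by (auto simp: r_coset_def)
    then have "center G #> (x \<otimes> y) = center G #> (y \<otimes> x)"
      using xy by (simp add: center_coset_iff)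
    then show "U \<otimes>\<^bsub>?Q\<^esub> T = T \<otimes>\<^bsub>?Q\<^esub> U" using xy by (simp add: N.rcos_sum)
  qed
  interpret quot: group_hom G ?Q "\<lambda>a. center G #> a"
    by unfold_locales (rule N.r_coset_hom_Mod)
  have Sc: "s \<in> carrier G" if "s \<in> S" for s using S(1) that by (rule subgroup.mem_carrier)
  have prod: "finprod ?Q (\<lambda>i. center G #> s i) A \<in> (\<lambda>s. center G #> s) ` S"
    if "finite A" "\<And>i. i \<in> A \<Longrightarrow> s i \<in> S" for s :: "nat \<Rightarrow> 'a" and A
    using that
  proof (induction A rule: finite_induct)
    case empty
    have "finprod ?Q (\<lambda>i. center G #> s i) {} = center G #> \<one>"
      by (simp only: Q.finprod_empty quot.hom_one)
    then show ?case using subgroup.one_closed[OF S(1)] by blast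
  next
    case (insert i A)
    have "finprod ?Q (\<lambda>i. center G #> s i) A \<in> (\<lambda>s. center G #> s) ` S"
      by (rule insert.IH) (use insert.prems in blast)+
    then obtain t where t: "t \<in> S" "finprod ?Q (\<lambda>i. center G #> s i) A = center G #> t"
      by blast
    have "finprod ?Q (\<lambda>i. center G #> s i) (insert i A)
        = (center G #> s i) \<otimes>\<^bsub>?Q\<^esub> finprod ?Q (\<lambda>i. center G #> s i) A"
    proof (rule Q.finprod_insert[OF insert.hyps(1,2)])
      show "(\<lambda>i. center G #> s i) \<in> A \<rightarrow> carrier ?Q"
        using insert.prems Sc quot.hom_closed by blast
      show "center G #> s i \<in> carrier ?Q"
        using insert.prems Sc quot.hom_closed by blast
    qed
    also have "\<dots> = center G #> (s i \<otimes> t)"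
      unfolding t(2)
      by (rule quot.hom_mult[OF Sc[OF insert.prems[OF insertI1]] Sc[OF t(1)], symmetric])
    finally show ?case
      using subgroup.m_closed[OF S(1) insert.prems[OF insertI1] t(1)] by blast
  qed
  have "x \<in> S" if x: "x \<in> carrier G" for x
  proof -
    obtain e f where ef: "center G #> x = V_comb G n v w e f"
      using conjunct2[OF basis[unfolded is_V_basis_def], THEN bspec, OF quot.hom_closed[OF x]]
      by (elim ex1E conjE) (rule that)
    have "V_comb G n v w e f = finprod ?Q (\<lambda>i. center G #> (v i [^] e i \<otimes> w i [^] f i)) {1..n}"
      unfolding V_comb_def
    proof (rule Q.finprod_cong')
      fix i assume "i \<in> {1..n}"
      then have "v i \<in> carrier G" "w i \<in> carrier G" using vw Sc by auto
      then show "(center G #> v i) [^]\<^bsub>?Q\<^esub> e i \<otimes>\<^bsub>?Q\<^esub> (center G #> w i) [^]\<^bsub>?Q\<^esub> f i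
          = center G #> (v i [^] e i \<otimes> w i [^] f i)"
        using quot.hom_mult[of "v i [^] e i" "w i [^] f i"] by (simp flip: quot.hom_nat_pow)
    qed (use vw Sc in \<open>auto simp: carrier_FactGroup\<close>)
    also have "\<dots> \<in> (\<lambda>s. center G #> s) ` S"
    proof (rule prod)
      have "y [^] k \<in> S" if "y \<in> S" for y and k :: nat
        using subgroup_int_pow_closed[OF S(1) that, of "int k"] by (simp add: int_pow_int)
      then show "v i [^] e i \<otimes> w i [^] f i \<in> S" if "i \<in> {1..n}" for i
        using vw[OF that] subgroup.m_closed[OF S(1)] by blast
    qed simp
    finally obtain s where s: "s \<in> S" "center G #> x = center G #> s" using ef by auto
    then have "x \<in> center G #> s" using center_coset_iff[OF x Sc[OF s(1)]] by blast
    then obtain c where c: "c \<in> center G" "x = c \<otimes> s" by (rule center_cosetE)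
    then show ?thesis using S(2) s(1) subgroup.m_closed[OF S(1)] by blast
  qed
  then show ?thesis using Sc by blast
qed

text \<open>Both sides are homomorphisms trivial on the center. They take the value \<open>z\<close>
  at \<open>v 1\<close> and are trivial at every other basis vector.\<close>

lemma special_symplectic_basis_pow_p:
  assumes basis: "special_symplectic_basis p G z n v w" and x: "x \<in> carrier G"
  shows "x [^] p = comm G x (w 1)"
proof -
  have n: "1 \<in> {1..n}" using basis by (simp add: special_symplectic_basis_def)
  have closed: "v i \<in> carrier G" "w i \<in> carrier G" if "i \<in> {1..n}" for i
    using basis that by (auto simp: special_symplectic_basis_def is_V_basis_def)
  note w1 = closed(2)[OF n]
  define S where "S = {x \<in> carrier G. x [^] p = comm G x (w 1)}"
  have "subgroup S G"
  proof (rule subgroupI)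
    show "S \<noteq> {}" using w1 subgroup.one_closed[OF center_subgroup] by (auto simp: S_def)
    show "inv a \<in> S" if "a \<in> S" for a
      using that w1 comm_pow_left(2)[of a "w 1" "- 1"] by (auto simp: S_def nat_pow_inv int_pow_neg)
    show "a \<otimes> b \<in> S" if "a \<in> S" "b \<in> S" for a b
      using that w1 by (auto simp: S_def pow_p_mult comm_mult_left)
  qed (auto simp: S_def)
  moreover have "center G \<subseteq> S"
    using w1 center_closed by (auto simp: S_def center_pow_p)
  moreover have "v i \<in> S \<and> w i \<in> S" if i: "i \<in> {1..n}" for i
  proof (cases "i = 1")
    case True
    then show ?thesis
      using basis n closed[OF n] by (simp add: S_def special_symplectic_basis_def)
  next
    case False
    then have "i \<in> {2..n}" using i by auto
    then show ?thesis
      using basis n i False closed[OF i] by (auto simp: S_def special_symplectic_basis_def)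
  qed
  ultimately have "S = carrier G"
    using basis by (intro V_basis_generates[where v = v and w = w]) (auto simp: special_symplectic_basis_def)
  then show ?thesis using x by (auto simp: S_def)
qed

text \<open>Duality applied to the \<open>p\<close>-th power map; it supplies \<open>w\<close> for
  the orbit count, which is stated without a basis.\<close>

lemma pow_p_eq_comm:
  obtains w where "w \<in> carrier G" "\<And>x. x \<in> carrier G \<Longrightarrow> x [^] p = comm G x w"
  using center_valued_hom_eq_comm[OF nondegenerate_carrier, of "\<lambda>x. x [^] p"]
    pow_p_center pow_p_mult center_pow_p by blast

end

subsection \<open>Orbits\<close>

text \<open>\<open>w\<close> is specified by its equation alone, so it may come from a basis or from
  duality. That it is not central encodes that the exponent is not \<open>p\<close>.\<close>

locale cyclic_center_class2_exp_p2 = cyclic_center_class2 +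
  fixes w
  assumes w_closed [simp, intro]: "w \<in> carrier G"
    and pow_p_eq: "x \<in> carrier G \<Longrightarrow> x [^] p = comm G x w"
    and w_not_center: "w \<notin> center G"
begin

text \<open>The preimage of the line spanned by \<open>w Z\<close>, zero vector included.\<close>

definition W :: "'a set" where
  "W = {x \<in> carrier G. \<exists>k::nat. center G #> x = center G #> w [^] k}"

lemma W_iff: "x \<in> W \<longleftrightarrow> (\<exists>k::nat. x \<in> center G #> w [^] k)"
  unfolding W_def using center_coset_iff center_coset_closed by fastforce

lemma w_pow_p: "w [^] p = \<one>"
  by (simp add: pow_p_eq)

lemma w_pow_mod: "w [^] (k mod p) = w [^] (k::nat)"
proof -
  have "w [^] int (k mod p) = w [^] int k"
    by (rule pow_cong) (simp_all add: w_pow_p cong_def zmod_int)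
  then show ?thesis by (simp only: int_pow_int)
qed

lemma W_intro:
  assumes "c \<in> center G" shows "c \<otimes> w [^] (i::int) \<in> W"
proof -
  have "w [^] i = w [^] (i mod int p)"
    by (rule pow_cong) (simp_all add: w_pow_p)
  also have "\<dots> = w [^] nat (i mod int p)"
    using p_prime by (simp add: prime_gt_0_nat flip: int_pow_int)
  finally show ?thesis using assms by (auto simp: W_iff r_coset_def)
qed

lemma W_pow_p:
  assumes "x \<in> W" shows "x [^] p = \<one>"
proof -
  obtain k :: nat where "x \<in> center G #> w [^] k" using assms W_iff by blast
  then obtain c where "c \<in> center G" "x = c \<otimes> w [^] k" by (rule center_cosetE)
  then show ?thesis
    by (simp add: pow_p_eq center_closed comm_mult_left comm_pow_left)
qed

lemma center_subset_W: "center G \<subseteq> W"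
  using W_intro[of _ 0] center_closed by auto

text \<open>Plays the part of the first basis vector \<open>v_1\<close>:
  \<open>v^p = [v, w] = z\<close>.\<close>

definition v :: 'a where "v = (SOME v. v \<in> carrier G \<and> comm G v w = z)"

lemma v: "v \<in> carrier G" "comm G v w = z"
proof -
  have "\<exists>v. v \<in> carrier G \<and> comm G v w = z"
    using not_centerE[OF w_closed w_not_center z_center] by metis
  then show "v \<in> carrier G" "comm G v w = z"
    unfolding v_def by (metis (mono_tags, lifting) someI_ex)+
qed

lemma v_pow_p: "v [^] p = z"
  using v pow_p_eq by simp

text \<open>The \<open>p\<close>-th power map sends \<open>v\<close> to a generator of the center,
  so a power of \<open>v\<close> corrects \<open>x\<close> to an element of the kernel.\<close>

lemma pow_p_decomposition:
  assumes x: "x \<in> carrier G"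
  obtains a and i :: int where "a \<in> carrier G" "a [^] p = \<one>" "x = a \<otimes> v [^] i"
proof -
  obtain i :: int where i: "x [^] p = z [^] i"
    using centerE pow_p_center[OF x] by metis
  have "(x \<otimes> v [^] (- i)) [^] p = \<one>"
    using x v i by (simp add: pow_p_mult pow_p_int_pow v_pow_p flip: int_pow_mult)
  moreover have "x = (x \<otimes> v [^] (- i)) \<otimes> v [^] i"
    using x v by (simp add: m_assoc flip: int_pow_mult)
  ultimately show thesis using that x v by (metis int_pow_closed m_closed)
qed

text \<open>\<open>W\<close> is the double centralizer of \<open>w\<close>, because \<open>a\<^sup>p = [a, w]\<close>.\<close>
lemma not_W_E:
  assumes x: "x \<in> carrier G" "x \<notin> W"
  obtains a where "a \<in> carrier G" "a [^] p = \<one>" "comm G x a \<noteq> \<one>"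
proof (rule ccontr)
  assume "\<not> thesis"
  then have xa: "comm G x a = \<one>" if "a \<in> carrier G" "a [^] p = \<one>" for a
    using that \<open>\<And>a. a \<in> carrier G \<Longrightarrow> a [^] p = \<one> \<Longrightarrow> comm G x a \<noteq> \<one> \<Longrightarrow> thesis\<close> by blast
  obtain m :: int where m: "comm G x v = z [^] m" using centerE comm_center x(1) v(1) by metis
  have wv: "comm G w v = z [^] (- 1 :: int)"
    using comm_inverse[of v w] v by (simp add: int_pow_neg)
  \<comment> \<open>The factor \<open>w^m\<close> makes \<open>y\<close> commute with
    \<open>v\<close>, because \<open>[w, v] = z^-1\<close>.\<close>
  define y where "y = x \<otimes> w [^] m"
  have y: "y \<in> carrier G" using x by (simp add: y_def)
  have yv: "comm G y v = \<one>"
    using x v m wv by (simp add: y_def comm_mult_left comm_pow_left int_pow_pow flip: int_pow_mult)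
  have "comm G y u = \<one>" if u: "u \<in> carrier G" for u
  proof -
    obtain a and i :: int where a: "a \<in> carrier G" "a [^] p = \<one>" "u = a \<otimes> v [^] i"
      using pow_p_decomposition[OF u] .
    \<comment> \<open>\<open>w\<close> centralizes every \<open>a\<close> with
      \<open>a^p = 1\<close>, so \<open>y\<close> still commutes with all of these; together with
      \<open>v\<close> they generate \<open>G\<close>.\<close>
    have "comm G w a = \<one>"
      using a(1,2) pow_p_eq[OF a(1)] by (simp add: comm_eq_one_iff)
    then have "comm G y a = \<one>"
      using x a xa by (simp add: y_def comm_mult_left comm_pow_left)
    then show ?thesis
      using y v yv a by (simp add: comm_mult_right comm_pow_right)
  qed
  then have "y \<in> center G" using y centerI by blast
  then have "y \<otimes> w [^] (- m) \<in> W" by (rule W_intro)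
  then show False
    using x by (simp add: y_def m_assoc flip: int_pow_mult)
qed

lemma automorphic_center:
  assumes "c \<in> center G" "c \<noteq> \<one>" "d \<in> center G" "d \<noteq> \<one>"
  shows "automorphic G c d"
  using multiplier_automorphism[OF assms] unfolding automorphic_def by metis

lemma automorphic_if_not_W:
  assumes g: "g \<in> carrier G" "g \<notin> W" and h: "h \<in> carrier G" "h \<notin> W" and "g [^] p = h [^] p"
  shows "automorphic G g h"
proof -
  obtain a where "a \<in> carrier G" "a [^] p = \<one>" "comm G g a \<noteq> \<one>"
    using not_W_E[OF g] .
  moreover obtain b where "b \<in> carrier G" "b [^] p = \<one>" "comm G h b \<noteq> \<one>"
    using not_W_E[OF h] .
  ultimately show ?thesis using assms by (intro automorphic_if_pow_p_eq[of g h a b])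
qed

text \<open>A similitude first carries \<open>g^p\<close> to \<open>h^p\<close>; then transvections
  apply, since elements with nontrivial \<open>p\<close>-th power lie outside
  \<open>W\<close>.\<close>

lemma automorphic_order_p2:
  assumes g: "g \<in> carrier G" "g [^] p \<noteq> \<one>" and h: "h \<in> carrier G" "h [^] p \<noteq> \<one>"
  shows "automorphic G g h"
proof -
  obtain \<phi> where \<phi>: "\<phi> \<in> iso G G" "\<phi> (g [^] p) = h [^] p"
    using multiplier_automorphism[OF pow_p_center[OF g(1)] g(2) pow_p_center[OF h(1)] h(2)] .
  have pg: "automorphic G g (\<phi> g)" using \<phi>(1) by (auto simp: automorphic_def)
  have pc: "\<phi> g \<in> carrier G" using pg g(1) by (rule automorphic_closed)
  have "\<phi> g [^] p = h [^] p"
    using \<phi> g(1) by (simp add: hom_pow iso_imp_homomorphism)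
  moreover from this have "\<phi> g \<notin> W" "h \<notin> W" using W_pow_p h by metis+
  ultimately have "automorphic G (\<phi> g) h"
    using pc h(1) by (intro automorphic_if_not_W)
  then show ?thesis using pg automorphic_trans by blast
qed

lemma automorphic_coset:
  assumes "g \<in> center G #> y" "h \<in> center G #> y" "y \<in> carrier G" "y \<notin> center G"
  shows "automorphic G g h"
proof -
  obtain c d where c: "c \<in> center G" "g = c \<otimes> y" and d: "d \<in> center G" "h = d \<otimes> y"
    using assms(1,2) center_cosetE by metis
  note cc = center_closed[OF c(1)] center_closed[OF d(1)]
  have "g \<notin> center G"
  proof
    assume "g \<in> center G"
    then have "inv c \<otimes> g \<in> center G"
      using c(1) center_subgroup by (simp add: subgroup.m_closed subgroup.m_inv_closed)
    then show False using assms(3,4) cc by (simp add: c(2) flip: m_assoc)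
  qed
  moreover have "d \<otimes> inv c \<in> center G"
    using c(1) d(1) center_subgroup by (simp add: subgroup.m_closed subgroup.m_inv_closed)
  ultimately have "automorphic G g ((d \<otimes> inv c) \<otimes> g)"
    using assms(3) cc c(2) by (intro automorphic_center_mult) auto
  also have "(d \<otimes> inv c) \<otimes> g = h"
    using assms(3) cc unfolding c(2) d(2) by (simp add: m_assoc) (simp flip: m_assoc)
  finally show ?thesis .
qed

text \<open>\<open>[\<phi> x, \<phi> w] = \<phi> (x^p) = (\<phi> x)^p = [\<phi> x, w]\<close>, even
  if \<open>\<phi>\<close> moves the center. As \<open>\<phi>\<close> is surjective,
  \<open>\<phi> w\<close> and \<open>w\<close> differ by a central element.\<close>

lemma automorphic_w_coset:
  assumes "automorphic G g h" "g \<in> center G #> w [^] (k::nat)"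
  shows "h \<in> center G #> w [^] k"
proof -
  obtain \<phi> where \<phi>: "\<phi> \<in> iso G G" "h = \<phi> g" using assms(1) by (auto simp: automorphic_def)
  have hom: "\<phi> \<in> hom G G" using \<phi>(1) by (rule iso_imp_homomorphism)
  have \<phi>w: "\<phi> w \<in> carrier G" using hom by (auto simp: hom_def)
  obtain c where c: "c \<in> center G" "g = c \<otimes> w [^] k" using assms(2) by (rule center_cosetE)
  have \<phi>c: "\<phi> c \<in> center G"
    using automorphic_center_iff[of c "\<phi> c"] c center_closed \<phi>(1) by (auto simp: automorphic_def)
  define d where "d = \<phi> w \<otimes> inv w"
  have "comm G y (\<phi> w) = comm G y w" if "y \<in> carrier G" for y
  proof -
    have "y \<in> \<phi> ` carrier G" using that \<phi>(1) by (simp add: iso_def bij_betw_def)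
    then obtain x where x: "x \<in> carrier G" "y = \<phi> x" by blast
    have "comm G y (\<phi> w) = \<phi> (x [^] p)"
      using x hom hom_comm[OF hom x(1) w_closed] by (simp add: pow_p_eq)
    also have "\<dots> = comm G y w"
      using x that hom by (simp add: hom_pow flip: pow_p_eq)
    finally show ?thesis .
  qed
  then have "comm G d y = \<one>" if "y \<in> carrier G" for y
    using that \<phi>w comm_pow_left(2)[of w y "- 1"] comm_inverse[of y w] comm_inverse[of y "\<phi> w"]
    by (simp add: d_def comm_mult_left int_pow_neg)
  then have d: "d \<in> center G" using \<phi>w by (intro centerI) (auto simp: d_def)
  then have "d [^] k \<in> center G"
    using subgroup_int_pow_closed[OF center_subgroup d, of "int k"] by (simp add: int_pow_int)
  then have dk: "\<phi> c \<otimes> d [^] k \<in> center G"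
    using \<phi>c center_subgroup by (simp add: subgroup.m_closed)
  have "\<phi> w = d \<otimes> w" using \<phi>w by (simp add: d_def m_assoc)
  then have "\<phi> w [^] k = d [^] k \<otimes> w [^] k"
    by (simp only: pow_mult_distrib[OF center_commute[OF d w_closed] center_closed[OF d] w_closed])
  then have "h = (\<phi> c \<otimes> d [^] k) \<otimes> w [^] k"
    using \<phi>(2) c hom center_closed[OF c(1)] center_closed[OF \<phi>c] center_closed[OF d]
    by (simp add: hom_pow hom_mult m_assoc)
  then show ?thesis using dk by (auto simp: r_coset_def)
qed

lemma automorphic_W:
  assumes "automorphic G g h" "g \<in> W" shows "h \<in> W"
  using assms automorphic_w_coset by (auto simp: W_iff)

lemma automorphic_sym:
  assumes "automorphic G g h" "g \<in> carrier G" shows "automorphic G h g"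
proof -
  obtain \<phi> where \<phi>: "\<phi> \<in> iso G G" "h = \<phi> g" using assms(1) by (auto simp: automorphic_def)
  then have "inj_on \<phi> (carrier G)" by (simp add: iso_def bij_betw_def)
  then have "inv_into (carrier G) \<phi> h = g" using \<phi>(2) assms(2) by simp
  then show ?thesis using iso_set_sym[OF \<phi>(1)] unfolding automorphic_def by blast
qed

text \<open>Equal orders make the \<open>p\<close>-th powers trivial together or nontrivial
  together. For noncentral elements, trivial powers leave a transvection problem outside
  \<open>W\<close>; otherwise a similitude comes first.\<close>

theorem automorphic_iff:
  assumes g: "g \<in> carrier G" "g \<in> center G \<or> g \<notin> W" and h: "h \<in> carrier G" "h \<in> center G \<or> h \<notin> W"
  shows "automorphic G g h \<longleftrightarrow> ord g = ord h \<and> (g \<in> center G \<longleftrightarrow> h \<in> center G)"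
proof
  assume "automorphic G g h"
  then show "ord g = ord h \<and> (g \<in> center G \<longleftrightarrow> h \<in> center G)"
    using g h automorphic_center_iff ord_eq_iff_pow automorphic_pow_eq_one_iff by metis
next
  assume *: "ord g = ord h \<and> (g \<in> center G \<longleftrightarrow> h \<in> center G)"
  then have pow: "g [^] n = \<one> \<longleftrightarrow> h [^] n = \<one>" for n :: nat
    using g h by (simp add: pow_eq_id)
  show "automorphic G g h"
  proof (cases "g \<in> center G")
    case True
    moreover have "g = \<one> \<longleftrightarrow> h = \<one>"
      using pow[of 1] g h by (metis nat_pow_eone)
    ultimately show ?thesis
      using * automorphic_center automorphic_refl by metis
  next
    case False
    then show ?thesis
      using * pow[of p] g h automorphic_if_not_W automorphic_order_p2 by metis
  qed
qed

section \<open>Counting the orbits\<close>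

definition K :: "'a set" where "K = {x \<in> carrier G. x [^] p = \<one>}"

lemma W_subset_K: "W \<subseteq> K"
  using W_pow_p by (auto simp: K_def W_def)

lemma p_ge_2: "p \<ge> 2"
  using p_prime prime_ge_2_nat by blast

lemma w_pow_center_iff: "w [^] (i::int) \<in> center G \<longleftrightarrow> int p dvd i"
proof
  assume "w [^] i \<in> center G"
  then have "comm G v (w [^] i) = \<one>" using v by simp
  then show "int p dvd i" using v by (simp add: comm_pow_right z_pow_eq_one_iff)
next
  assume "int p dvd i"
  then have "w [^] i = w [^] (0::int)" using w_pow_p by (intro pow_cong) (simp_all add: cong_0_iff)
  then show "w [^] i \<in> center G" using subgroup.one_closed[OF center_subgroup] by simp
qed

lemma w_coset_eq_iff:
  assumes "k < p" "l < p"
  shows "center G #> w [^] k = center G #> w [^] l \<longleftrightarrow> k = l"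
proof
  assume "center G #> w [^] k = center G #> w [^] l"
  then have "w [^] k \<in> center G #> w [^] l" by (simp add: center_coset_iff)
  then obtain c where c: "c \<in> center G" "w [^] k = c \<otimes> w [^] l" by (rule center_cosetE)
  then have "w [^] (int k - int l) = c"
    using center_closed by (simp add: int_pow_diff int_pow_int m_assoc)
  then have "int p dvd int k - int l" using c(1) w_pow_center_iff by metis
  then show "k = l"
    using assms by (simp add: cong_iff_dvd_diff[symmetric] cong_int_iff cong_less_modulus_unique_nat)
qed simp

lemma card_W: "card W = p\<^sup>2"
proof -
  have "bij_betw (\<lambda>(c, k). c \<otimes> w [^] k) (center G \<times> {..<p}) W"
  proof (rule bij_betwI')
    fix a b assume "a \<in> center G \<times> {..<p}" "b \<in> center G \<times> {..<p}"
    then obtain c k d l where ab: "a = (c, k)" "b = (d, l)" "c \<in> center G" "d \<in> center G" "k < p" "l < p"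
      by auto
    have "c \<otimes> w [^] k \<in> center G #> w [^] k" "d \<otimes> w [^] l \<in> center G #> w [^] l"
      using ab by (auto simp: r_coset_def)
    then have "k = l" if "c \<otimes> w [^] k = d \<otimes> w [^] l"
      using that w_coset_eq_iff[OF ab(5,6)]
      by (metis center_coset_closed center_coset_iff nat_pow_closed w_closed)
    then show "((case a of (c, k) \<Rightarrow> c \<otimes> w [^] k) = (case b of (c, k) \<Rightarrow> c \<otimes> w [^] k)) = (a = b)"
      using ab center_closed by auto
  next
    fix a assume "a \<in> center G \<times> {..<p}"
    then show "(case a of (c, k) \<Rightarrow> c \<otimes> w [^] k) \<in> W"
      by (auto simp: W_iff r_coset_def)
  next
    fix x assume "x \<in> W"
    then obtain k :: nat where "x \<in> center G #> w [^] k" using W_iff by blast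
    then obtain c where c: "c \<in> center G" "x = c \<otimes> w [^] k" by (rule center_cosetE)
    show "\<exists>a\<in>center G \<times> {..<p}. x = (case a of (c, k) \<Rightarrow> c \<otimes> w [^] k)"
      using c p_ge_2 by (intro bexI[of _ "(c, k mod p)"]) (auto simp: w_pow_mod)
  qed
  then show ?thesis
    by (simp add: bij_betw_same_card[symmetric] card_center power2_eq_square card_cartesian_product)
qed

text \<open>\<open>K\<close> is the kernel of the \<open>p\<close>-th power map onto the center, and
  the powers \<open>v^k\<close> with \<open>k < p\<close> represent its cosets because their
  \<open>p\<close>-th powers are \<open>z^k\<close>.\<close>

lemma card_carrier: "card (carrier G) = card K * p"
proof -
  have "bij_betw (\<lambda>(a, k). a \<otimes> v [^] k) (K \<times> {..<p}) (carrier G)"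
  proof (rule bij_betwI')
    fix x y assume "x \<in> K \<times> {..<p}" "y \<in> K \<times> {..<p}"
    then obtain a k b l where xy: "x = (a, k)" "y = (b, l)" "a \<in> K" "b \<in> K" "k < p" "l < p"
      by auto
    have "k = l" if eq: "a \<otimes> v [^] k = b \<otimes> v [^] l"
    proof -
      have "(v [^] m) [^] p = z [^] int m" for m :: nat
        using v v_pow_p by (metis nat_pow_pow mult.commute int_pow_int)
      then have "(a \<otimes> v [^] k) [^] p = z [^] int k" "(b \<otimes> v [^] l) [^] p = z [^] int l"
        using xy v by (simp_all add: K_def pow_p_mult)
      then have "[int k = int l] (mod int p)" using eq z_pow_eq_iff by metis
      then show ?thesis
        using xy by (simp add: cong_int_iff cong_less_modulus_unique_nat)
    qed
    then show "((case x of (a, k) \<Rightarrow> a \<otimes> v [^] k) = (case y of (a, k) \<Rightarrow> a \<otimes> v [^] k)) = (x = y)"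
      using xy v by (auto simp: K_def)
  next
    fix x assume "x \<in> K \<times> {..<p}"
    then show "(case x of (a, k) \<Rightarrow> a \<otimes> v [^] k) \<in> carrier G" using v by (auto simp: K_def)
  next
    fix x assume x: "x \<in> carrier G"
    obtain a and i :: int where a: "a \<in> carrier G" "a [^] p = \<one>" "x = a \<otimes> v [^] i"
      using pow_p_decomposition[OF x] .
    define k where "k = nat (i mod int p)"
    have k: "k < p" "int k = i mod int p" using p_ge_2 by (auto simp: k_def nat_less_iff)
    \<comment> \<open>The multiple of \<open>p\<close> in the exponent yields a power of
      \<open>v^p = z\<close>, which is absorbed into the factor from \<open>K\<close>.\<close>
    have "i = int k + int p * (i div int p)" by (simp add: k)
    then have "v [^] i = v [^] int k \<otimes> (v [^] int p) [^] (i div int p)"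
      using v by (metis int_pow_mult int_pow_pow)
    then have vi: "v [^] i = z [^] (i div int p) \<otimes> v [^] k"
      using v by (simp add: int_pow_int v_pow_p center_commute[OF z_pow_center])
    have "a \<otimes> z [^] (i div int p) \<in> K"
      using a by (simp add: K_def pow_p_mult center_pow_p)
    moreover have "x = (a \<otimes> z [^] (i div int p)) \<otimes> v [^] k"
      using a v by (simp add: vi m_assoc)
    ultimately show "\<exists>y\<in>K \<times> {..<p}. x = (case y of (a, k) \<Rightarrow> a \<otimes> v [^] k)"
      using k by (intro bexI[of _ "(a \<otimes> z [^] (i div int p), k)"]) auto
  qed
  then show ?thesis
    by (simp add: bij_betw_same_card[symmetric] card_cartesian_product)
qed

text \<open>Compares \<open>|W| = p^2\<close> with \<open>|K| = |G| / p\<close>; this is the source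
  of the case distinction in the orbit count.\<close>

lemma W_eq_K_iff: "W = K \<longleftrightarrow> card (carrier G) = p ^ 3"
proof -
  have "finite K" using finite_carrier by (simp add: K_def)
  then have "W = K \<longleftrightarrow> card W = card K"
    using W_subset_K card_subset_eq by metis
  also have "\<dots> \<longleftrightarrow> card (carrier G) = p ^ 3"
    using p_ge_2 by (auto simp: card_W card_carrier power2_eq_square power3_eq_cube)
  finally show ?thesis .
qed

lemma orbit_eqI:
  assumes "g \<in> U" "\<And>h. h \<in> U \<Longrightarrow> automorphic G g h" "\<And>h. automorphic G g h \<Longrightarrow> h \<in> U"
  shows "{h. automorphic G g h} = U"
  using assms by blast

lemma orbit_one: "{h. automorphic G \<one> h} = {\<one>}"
  using automorphic_refl automorphic_pow_eq_one_iff[of \<one> _ 1] automorphic_closed[of \<one>]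
  by (intro orbit_eqI) auto

lemma orbit_center:
  assumes "g \<in> center G - {\<one>}" shows "{h. automorphic G g h} = center G - {\<one>}"
proof (rule orbit_eqI[OF assms])
  have g: "g \<in> carrier G" using assms center_closed by blast
  show "h \<in> center G - {\<one>}" if "automorphic G g h" for h
    using assms automorphic_center_iff[OF that g] automorphic_pow_eq_one_iff[OF that g, of 1]
      automorphic_closed[OF that g] g by simp
qed (use assms automorphic_center in blast)

lemma orbit_order_p2:
  assumes "g \<in> carrier G - K" shows "{h. automorphic G g h} = carrier G - K"
proof (rule orbit_eqI[OF assms])
  have g: "g \<in> carrier G" using assms by blast
  show "h \<in> carrier G - K" if "automorphic G g h" for h
    using assms automorphic_pow_eq_one_iff[OF that g, of p] automorphic_closed[OF that g]
    by (simp add: K_def)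
  show "automorphic G g h" if "h \<in> carrier G - K" for h
    using assms that by (intro automorphic_order_p2) (auto simp: K_def)
qed

lemma orbit_order_p:
  assumes "g \<in> K - W" shows "{h. automorphic G g h} = K - W"
proof (rule orbit_eqI[OF assms])
  fix h assume h: "automorphic G g h"
  have g: "g \<in> carrier G" using assms by (simp add: K_def)
  have "h \<notin> W"
    using automorphic_W[OF automorphic_sym[OF h g]] assms by blast
  then show "h \<in> K - W"
    using assms h automorphic_closed[OF h g] automorphic_pow_eq_one_iff[OF h g, of p]
    by (simp add: K_def)
next
  fix h assume "h \<in> K - W"
  then show "automorphic G g h"
    using assms by (intro automorphic_if_not_W) (auto simp: K_def)
qed

lemma w_pow_not_center: "k \<in> {1..<p} \<Longrightarrow> w [^] k \<notin> center G"
  using w_pow_center_iff[of "int k"] by (auto simp: int_pow_int dest: dvd_imp_le)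

lemma orbit_w:
  assumes "k \<in> {1..<p}" "g \<in> center G #> w [^] k"
  shows "{h. automorphic G g h} = center G #> w [^] k"
  using assms automorphic_coset w_pow_not_center automorphic_w_coset by (intro orbit_eqI) auto

lemma W_cases:
  assumes "g \<in> W" "g \<notin> center G"
  obtains k where "k \<in> {1..<p}" "g \<in> center G #> w [^] k"
proof -
  obtain k :: nat where "g \<in> center G #> w [^] k" using assms W_iff by blast
  then have k: "g \<in> center G #> w [^] (k mod p)" by (simp add: w_pow_mod)
  moreover have "k mod p \<noteq> 0"
  proof
    assume "k mod p = 0"
    then have "g \<in> center G #> \<one>" using k by simp
    then show False using assms(2) center_closed by (metis center_cosetE r_one)
  qed
  ultimately show thesis using that[of "k mod p"] p_ge_2 by simp
qed

lemma w_pow_mem_coset: "w [^] (k::nat) \<in> center G #> w [^] k"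
  using rcos_self[OF _ center_subgroup] by simp

lemma w_pow_W: "w [^] (k::nat) \<in> W"
  using w_pow_mem_coset W_iff by blast

text \<open>\<open>K - W\<close> is listed only when nonempty, as orbits are nonempty;
  \<open>k\<close> starts at 1 because the coset for \<open>k = 0\<close> is the center, which
  splits into two orbits.\<close>

lemma aut_orbits_classification:
  "aut_orbits G = {{\<one>}, center G - {\<one>}, carrier G - K} \<union>
    ((if W = K then {} else {K - W}) \<union> (\<lambda>k. center G #> w [^] k) ` {1..<p})"
  (is "_ = ?R")
proof
  show "aut_orbits G \<subseteq> ?R"
  proof
    fix U assume "U \<in> aut_orbits G"
    then obtain g where g: "g \<in> carrier G" "U = {h. automorphic G g h}"
      by (auto simp: aut_orbits_eq)
    consider "g = \<one>" | "g \<in> center G - {\<one>}" | "g \<in> carrier G - K" | "g \<in> K - W"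
      | "g \<in> W" "g \<notin> center G"
      using g by blast
    then show "U \<in> ?R"
    proof cases
      case 5
      then obtain k where "k \<in> {1..<p}" "g \<in> center G #> w [^] k" by (rule W_cases)
      then show ?thesis using orbit_w g by auto
    qed (use g W_subset_K orbit_one orbit_center orbit_order_p2 orbit_order_p in auto)
  qed
  have orb: "{h. automorphic G g h} \<in> aut_orbits G" if "g \<in> carrier G" for g
    using that by (auto simp: aut_orbits_eq)
  have "v \<in> carrier G - K" using v v_pow_p z_nontrivial by (simp add: K_def)
  moreover have "z \<in> center G - {\<one>}" using z_center z_nontrivial by simp
  moreover have "K - W \<in> aut_orbits G" if "W \<noteq> K"
  proof -
    have "W \<subset> K" using that W_subset_K by blast
    then obtain g where g: "g \<in> K - W" by blast
    then show ?thesis using orb[of g] orbit_order_p[OF g] by (simp add: K_def)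
  qed
  moreover have "center G #> w [^] k \<in> aut_orbits G" if "k \<in> {1..<p}" for k
    using orb[of "w [^] k"] orbit_w[OF that w_pow_mem_coset] by simp
  ultimately show "?R \<subseteq> aut_orbits G"
    using orb[OF one_closed] orb[OF z_closed] orb[OF v(1)] orbit_one orbit_center[of z]
      orbit_order_p2[of v]
    by (auto split: if_splits)
qed

text \<open>The summands are 3, then 0 or 1 for \<open>K - W\<close>, then \<open>p - 1\<close>. The
  elements \<open>1\<close>, \<open>z\<close>, \<open>v\<close> and \<open>w^k\<close> serve as
  witnesses that the listed sets differ.\<close>

theorem card_aut_orbits: "card (aut_orbits G) = (if card (carrier G) = p ^ 3 then p + 2 else p + 3)"
proof -
  let ?A = "{{\<one>}, center G - {\<one>}, carrier G - K}"
  let ?B = "if W = K then {} else {K - W}"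
  let ?C = "(\<lambda>k. center G #> w [^] k) ` {1..<p}"
  have one: "\<one> \<in> center G" "\<one> \<in> K" "\<one> \<in> W"
    using subgroup.one_closed[OF center_subgroup] center_subset_W by (auto simp: K_def)
  have zz: "z \<in> center G" "z \<in> K" "z \<in> W"
    using z_center center_subset_W W_subset_K by auto
  have "v \<notin> K" using v v_pow_p z_nontrivial by (simp add: K_def)
  then have v': "v \<in> carrier G - K" "v \<notin> center G" "v \<noteq> \<one>"
    using v(1) one center_subset_W W_subset_K by auto
  have "{\<one>} \<noteq> center G - {\<one>}" "{\<one>} \<noteq> carrier G - K" "center G - {\<one>} \<noteq> carrier G - K"
    using one zz v' by auto
  then have A: "card ?A = 3" by simp
  have B: "card ?B = (if W = K then 0 else 1)" by simp
  have "inj_on (\<lambda>k. center G #> w [^] k) {1..<p}"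
    by (rule inj_onI) (use w_coset_eq_iff in auto)
  then have C: "card ?C = p - 1" by (simp add: card_image)
  have wk: "w [^] k \<notin> center G" "w [^] k \<in> W" "w [^] k \<in> K" "w [^] k \<noteq> \<one>"
    if "k \<in> {1..<p}" for k
    using w_pow_not_center[OF that] w_pow_W[of k] W_subset_K one by auto
  have "K - W \<noteq> center G #> w [^] k" for k :: nat
    using w_pow_W w_pow_mem_coset by blast
  then have BC: "?B \<inter> ?C = {}" by auto
  have "K - W \<noteq> {\<one>}" "K - W \<noteq> center G - {\<one>}" "K - W \<noteq> carrier G - K"
    using one zz v' z_nontrivial by blast+
  then have "?A \<inter> ?B = {}" by simp
  moreover have "center G #> w [^] k \<noteq> {\<one>} \<and> center G #> w [^] k \<noteq> center G - {\<one>} \<and>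
      center G #> w [^] k \<noteq> carrier G - K" if "k \<in> {1..<p}" for k
    using wk[OF that] w_pow_mem_coset[of k] by blast
  then have "?A \<inter> ?C = {}" by blast
  ultimately have "?A \<inter> (?B \<union> ?C) = {}" by blast
  then have "card (aut_orbits G) = card ?A + card (?B \<union> ?C)"
    unfolding aut_orbits_classification by (intro card_Un_disjoint) auto
  also have "card (?B \<union> ?C) = card ?B + card ?C"
    using BC by (intro card_Un_disjoint) auto
  finally show ?thesis
    using p_ge_2 unfolding A B C W_eq_K_iff by simp
qed

end

section \<open>Application to extraspecial groups of exponent \<open>p^2\<close>\<close>

theorem theorem4p8:
  fixes p :: nat and G :: "('a, 'b) monoid_scheme"
  assumes "Factorial_Ring.prime p" and "odd p"
    and "extraspecial_p_group p G"
    and "group_exponent G = p ^ 2"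
  shows "(\<forall>z n v w. special_symplectic_basis p G z n v w \<longrightarrow>
            (\<forall>g \<in> carrier G. \<forall>h \<in> carrier G.
               \<not> ((\<exists>k::nat. center G #>\<^bsub>G\<^esub> g = center G #>\<^bsub>G\<^esub> (w 1 [^]\<^bsub>G\<^esub> k)) \<and> g \<notin> center G) \<longrightarrow>
               \<not> ((\<exists>k::nat. center G #>\<^bsub>G\<^esub> h = center G #>\<^bsub>G\<^esub> (w 1 [^]\<^bsub>G\<^esub> k)) \<and> h \<notin> center G) \<longrightarrow>
               (automorphic G g h \<longleftrightarrow>
                  (group.ord G g = group.ord G h \<and> (g \<in> center G \<longleftrightarrow> h \<in> center G)))))
       \<and> card (aut_orbits G) = (if card (carrier G) = p ^ 3 then p + 2 else p + 3)"
proof -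
  have sp: "special_p_group p G" and card_center: "card (center G) = p"
    using assms(3) by (auto simp: extraspecial_p_group_def)
  then have "p_group p G" and derived: "center G = derived G (carrier G)"
    by (auto simp: special_p_group_def)
  then have grp: "group G" and fin: "finite (carrier G)"
    by (auto simp: p_group_def)
  interpret group G by (rule grp)
  have "comm G x y \<in> center G" if "x \<in> carrier G" "y \<in> carrier G" for x y
    unfolding derived derived_def comm_def using that by (intro generate.incl) blast
  then have class2: "cyclic_center_class2 G p z" if "z \<in> center G" "z \<noteq> \<one>\<^bsub>G\<^esub>" for z
    using that assms(1,2) fin card_center by unfold_locales
  \<comment> \<open>\<open>group_exponent\<close> is a least exponent, so if all \<open>p\<close>-th
    powers were trivial it would be at most \<open>p\<close>, which is less than
    \<open>p^2\<close>.\<close>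
  have "\<not> (0 < p \<and> (\<forall>x\<in>carrier G. x [^]\<^bsub>G\<^esub> p = \<one>\<^bsub>G\<^esub>))"
  proof
    assume "0 < p \<and> (\<forall>x\<in>carrier G. x [^]\<^bsub>G\<^esub> p = \<one>\<^bsub>G\<^esub>)"
    then have "group_exponent G \<le> p" unfolding group_exponent_def by (rule Least_le)
    then show False
      using assms(4) prime_gt_1_nat[OF assms(1)] by (simp add: power2_eq_square)
  qed
  then obtain a where a: "a \<in> carrier G" "a [^]\<^bsub>G\<^esub> p \<noteq> \<one>\<^bsub>G\<^esub>"
    using prime_gt_0_nat[OF assms(1)] by blast
  have exp_p2: "cyclic_center_class2_exp_p2 G p z w"
    if z: "z \<in> center G" "z \<noteq> \<one>\<^bsub>G\<^esub>" and w: "w \<in> carrier G"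
      and pow: "\<And>x. x \<in> carrier G \<Longrightarrow> x [^]\<^bsub>G\<^esub> p = comm G x w" for z w
  proof -
    interpret cyclic_center_class2 G p z by (rule class2[OF z])
    show ?thesis
    proof
      \<comment> \<open>For central \<open>w\<close> the equation would give
        \<open>a^p = [a, w] = 1\<close>.\<close>
      show "w \<notin> center G" using a pow[OF a(1)] by auto
    qed (fact w pow)+
  qed
  have "automorphic G g h \<longleftrightarrow>
      group.ord G g = group.ord G h \<and> (g \<in> center G \<longleftrightarrow> h \<in> center G)"
    if basis: "special_symplectic_basis p G z n v w"
      and gh: "g \<in> carrier G" "h \<in> carrier G"
      and g: "\<not> ((\<exists>k::nat. center G #>\<^bsub>G\<^esub> g = center G #>\<^bsub>G\<^esub> (w 1 [^]\<^bsub>G\<^esub> k)) \<and> g \<notin> center G)"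
      and h: "\<not> ((\<exists>k::nat. center G #>\<^bsub>G\<^esub> h = center G #>\<^bsub>G\<^esub> (w 1 [^]\<^bsub>G\<^esub> k)) \<and> h \<notin> center G)"
    for z n v w g h
  proof -
    have z: "z \<in> center G" "z \<noteq> \<one>\<^bsub>G\<^esub>" and w: "w 1 \<in> carrier G"
      using basis by (auto simp: special_symplectic_basis_def is_V_basis_def)
    interpret cyclic_center_class2_exp_p2 G p z "w 1"
      using z w cyclic_center_class2.special_symplectic_basis_pow_p[OF class2[OF z] basis]
      by (rule exp_p2)
    show ?thesis
      using gh g h by (intro automorphic_iff) (unfold W_def, blast+)
  qed
  moreover have "card (aut_orbits G) = (if card (carrier G) = p ^ 3 then p + 2 else p + 3)"
  proof -
    have "center G \<noteq> {\<one>\<^bsub>G\<^esub>}" "center G \<noteq> {}"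
      using card_center prime_gt_1_nat[OF assms(1)] by auto
    then obtain z where z: "z \<in> center G" "z \<noteq> \<one>\<^bsub>G\<^esub>" by blast
    obtain w where "w \<in> carrier G" "\<And>x. x \<in> carrier G \<Longrightarrow> x [^]\<^bsub>G\<^esub> p = comm G x w"
      using cyclic_center_class2.pow_p_eq_comm[OF class2[OF z]] by blast
    then show ?thesis
      using cyclic_center_class2_exp_p2.card_aut_orbits[OF exp_p2[OF z]] by blast
  qed
  ultimately show ?thesis by blast
qed

end
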